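(* Let $G$ be a connected finite simple graph on $[n]$, and let $\mathcal{S}\in\min(G)$. Then $$\mathrm{v}_{P_{\mathcal{S}}}(J_G)\;\le\;\min\{\,|A_1|+2|A_2| \;:\; A\in\mathcal{T}(\mathcal{S})\,\}.$$ Moreover, equality holds if the ideal $J_G+J_{\mathcal{T}(\mathcal{S})}$ is radical.
   Context: Let $R=\mathbb{C}[x_1,\dots,x_n,y_1,\dots,y_n]$ with the standard grading, and $f_{i,j}=x_iy_j-x_jy_i$. For a simple graph $G$ on $[n]=\{1,\dots,n\}$, the binomial edge ideal is $J_G=(f_{i,j} : \{i,j\}\in E(G),\ i<j)\subset R$. For $W\subseteq[n]$, $G_W$ denotes the induced subgraph on $W$. Cuts. A vertex $i$ is a cut point of a graph $H$ if $H$ has fewer connected components than the graph obtained from $H$ by deleting $i$. A nonempty $\mathcal{S}\subsetneq[n]$ is a minimal $k$-cut of $G$ if $G_{[n]\setminus\mathcal{S}}$ has exactly $k$ connected components and each $i\in\mathcal{S}$ is a cut point of $G_{([n]\setminus\mathcal{S})\cup\{i\}}$. $\min(G)$ is the set of all minimal $k$-cuts of $G$, $k\ge2$, together with $\emptyset$. Primes. For $\mathcal{S}\subseteq[n]$, let $G_1,\dots,G_c$ be the connected components of $G_{[n]\setminus\mathcal{S}}$ and put $P_{\mathcal{S}}=(x_i,y_i : i\in\mathcal{S})+\sum_{t=1}^{c}(f_{i,j} : i<j,\ i,j\in V(G_t))$. This is a prime ideal; for $G$ connected, the minimal primes of $J_G$ are exactly the $P_{\mathcal{S}}$ with $\mathcal{S}\in\min(G)$.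 Localized v-number. For a homogeneous ideal $I$ and $\mathfrak{p}\in\mathrm{Ass}(I)$, $\mathrm{v}_{\mathfrak{p}}(I)=\min\{d\ge0 : \exists f \text{ homogeneous of degree } d \text{ with } (I:f)=\mathfrak{p}\}$. Matroid dependencies. For $\mathcal{S}\subseteq[n]$, let $G_1,\dots,G_c$ be the connected components of the induced subgraph $G_{[n]\setminus\mathcal{S}}$; then $\mathcal{D}(M(\mathcal{S}))$ is the collection of all $B\subseteq[n]$ such that $B\cap\mathcal{S}\ne\emptyset$, or $|B\cap V(G_t)|\ge2$ for some $t\in\{1,\dots,c\}$, or $|B|\ge3$ (the dependent sets of a matroid $M(\mathcal{S})$ of rank at most two on $[n]$). Transversals. For a collection $\Delta$ of subsets of a set, a transversal of $\Delta$ is a subset $A\subseteq\bigcup_{e\in\Delta}e$ with $A\cap e\neq\emptyset$ for all $e\in\Delta$. For $\mathcal{S}\in\min(G)$ let $\Delta_{\mathcal{S}}=\{\mathcal{D}(M(\mathcal{S}'))\setminus\mathcal{D}(M(\mathcal{S})) : \mathcal{S}'\in\min(G)\setminus\{\mathcal{S}\}\}$, whose members are subsets of $\big(\binom{[n]}{1}\cup\binom{[n]}{2}\big)\setminus\mathcal{D}(M(\mathcal{S}))$, and let $\mathcal{T}(\mathcal{S})$ be the set of all transversals of $\Delta_{\mathcal{S}}$. Each $A\in\mathcal{T}(\mathcal{S})$ is uniquely $A=A_1\amalg A_2$ with $A_1\subseteq\binom{[n]}{1}$ and $A_2\subseteq\binom{[n]}{2}$; $A_1$ is identified with a subset of $[n]$.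 Transversal ideal. For $A\in\mathcal{T}(\mathcal{S})$ and $A_1=C\amalg D$ (disjoint union, parts possibly empty), $g_{A,C,D}=\prod_{k\in C}x_k\prod_{k\in D}y_k\prod_{\{i,j\}\in A_2}f_{i,j}$ ($f_{i,j}$ is determined up to sign by $\{i,j\}$). Finally $J_{\mathcal{T}(\mathcal{S})}=(g_{A,C,D} : A\in\mathcal{T}(\mathcal{S}),\ C\amalg D=A_1)$. *)

theory Defs
  imports Complex_Main "HOL-Library.Poly_Mapping" "HOL-Library.Set_Algebras"
    "HOL-Library.Extended_Nat"
begin

type_synonym 'v sgraph = "'v set \<times> 'v set set"

abbreviation verts :: "'v sgraph \<Rightarrow> 'v set" where "verts \<equiv> fst"
abbreviation edges :: "'v sgraph \<Rightarrow> 'v set set" where "edges \<equiv> snd"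

definition simple_graph :: "'v sgraph \<Rightarrow> bool" where
  "simple_graph G \<longleftrightarrow> finite (verts G) \<and> (\<forall>e\<in>edges G. e \<subseteq> verts G \<and> card e = 2)"

definition induced :: "'v sgraph \<Rightarrow> 'v set \<Rightarrow> 'v sgraph" where
  "induced G W = (W, {e \<in> edges G. e \<subseteq> W})"

text \<open>Connected components are represented by their vertex sets.\<close>

definition components :: "'v sgraph \<Rightarrow> 'v set set" where
  "components G = verts G // {(u, v) \<in> verts G \<times> verts G. (u, v) \<in> {(a, b). {a, b} \<in> edges G}\<^sup>*}"

definition connected_graph :: "'v sgraph \<Rightarrow> bool" where
  "connected_graph G \<longleftrightarrow> card (components G) = 1"

definition cut_point :: "'v sgraph \<Rightarrow> 'v \<Rightarrow> bool" where
  "cut_point H i \<longleftrightarrow> i \<in> verts H \<and>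
     card (components H) < card (components (induced H (verts H - {i})))"

definition minimal_cut :: "'v sgraph \<Rightarrow> nat \<Rightarrow> 'v set \<Rightarrow> bool" where
  "minimal_cut G k S \<longleftrightarrow> S \<noteq> {} \<and> S \<subset> verts G \<and>
     card (components (induced G (verts G - S))) = k \<and>
     (\<forall>i\<in>S. cut_point (induced G ((verts G - S) \<union> {i})) i)"

definition min_cuts :: "'v sgraph \<Rightarrow> 'v set set" where
  "min_cuts G = {S. \<exists>k\<ge>2. minimal_cut G k S} \<union> {{}}"

text \<open>The multiplication of a commutative ring makes it a module over itself; its submodules
  are the ideals.\<close>

lemma module_times: "module ((*) :: 'a::comm_ring_1 \<Rightarrow> 'a \<Rightarrow> 'a)"
  by unfold_locales (simp_all add: algebra_simps)

definition ideal_gen :: "'a::comm_ring_1 set \<Rightarrow> 'a set" where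
  "ideal_gen B = module.span (*) B"

definition colon :: "'a::comm_ring_1 set \<Rightarrow> 'a \<Rightarrow> 'a set" where
  "colon I f = {g. g * f \<in> I}"

definition radical :: "'a::comm_ring_1 set \<Rightarrow> 'a set" where
  "radical I = {f. \<exists>k. f ^ k \<in> I}"

definition is_radical :: "'a::comm_ring_1 set \<Rightarrow> bool" where
  "is_radical I \<longleftrightarrow> radical I = I"

text \<open>The polynomial ring in the variables \<open>x\<^sub>i\<close>, encoded as \<open>(False, i)\<close>, and
  \<open>y\<^sub>i\<close>, encoded as \<open>(True, i)\<close>. The index type \<open>'n\<close>, a finite linear order,
  plays the role of \<open>[n]\<close>.\<close>

type_synonym 'n mono = "(bool \<times> 'n) \<Rightarrow>\<^sub>0 nat"
type_synonym 'n xypoly = "'n mono \<Rightarrow>\<^sub>0 complex"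

definition xvar :: "'n \<Rightarrow> 'n xypoly" where
  "xvar i = Poly_Mapping.single (Poly_Mapping.single (False, i) 1) 1"

definition yvar :: "'n \<Rightarrow> 'n xypoly" where
  "yvar i = Poly_Mapping.single (Poly_Mapping.single (True, i) 1) 1"

definition fbin :: "'n \<Rightarrow> 'n \<Rightarrow> 'n xypoly" where
  "fbin i j = xvar i * yvar j - xvar j * yvar i"

definition mono_degree :: "'n mono \<Rightarrow> nat" where
  "mono_degree m = (\<Sum>v\<in>Poly_Mapping.keys m. Poly_Mapping.lookup m v)"

definition homogeneous :: "nat \<Rightarrow> 'n xypoly \<Rightarrow> bool" where
  "homogeneous d p \<longleftrightarrow> (\<forall>m\<in>Poly_Mapping.keys p. mono_degree m = d)"

text \<open>The localized v-number takes values in \<open>enat\<close>: it is \<open>\<infinity>\<close> if no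
  homogeneous polynomial has \<open>P\<close> as its colon ideal, and otherwise the infimum is a minimum.\<close>

definition v_number :: "'n xypoly set \<Rightarrow> 'n xypoly set \<Rightarrow> enat" where
  "v_number P I = Inf {enat d | d. \<exists>h. homogeneous d h \<and> colon I h = P}"

definition binomial_edge_ideal :: "'n::linorder sgraph \<Rightarrow> 'n xypoly set" where
  "binomial_edge_ideal G = ideal_gen {fbin i j | i j. {i, j} \<in> edges G \<and> i < j}"

definition cut_prime :: "'n::linorder sgraph \<Rightarrow> 'n set \<Rightarrow> 'n xypoly set" where
  "cut_prime G S = ideal_gen (xvar ` S \<union> yvar ` S) +
     (\<Sum>C\<in>components (induced G (verts G - S)).
        ideal_gen {fbin i j | i j. i < j \<and> i \<in> C \<and> j \<in> C})"

definition dependent_sets :: "'n sgraph \<Rightarrow> 'n set \<Rightarrow> 'n set set" where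
  "dependent_sets G S = {B. B \<subseteq> verts G \<and>
     (B \<inter> S \<noteq> {} \<or>
      (\<exists>C\<in>components (induced G (verts G - S)). card (B \<inter> C) \<ge> 2) \<or>
      card B \<ge> 3)}"

definition transversals :: "'a set set \<Rightarrow> 'a set set" where
  "transversals \<Delta> = {A. A \<subseteq> \<Union>\<Delta> \<and> (\<forall>e\<in>\<Delta>. A \<inter> e \<noteq> {})}"

definition cut_Delta :: "'n sgraph \<Rightarrow> 'n set \<Rightarrow> 'n set set set" where
  "cut_Delta G S = {dependent_sets G S' - dependent_sets G S | S'. S' \<in> min_cuts G - {S}}"

definition cut_transversals :: "'n sgraph \<Rightarrow> 'n set \<Rightarrow> 'n set set set" where
  "cut_transversals G S = transversals (cut_Delta G S)"

definition part1 :: "'n set set \<Rightarrow> 'n set" where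
  "part1 A = {k. {k} \<in> A}"

definition part2 :: "'n set set \<Rightarrow> 'n set set" where
  "part2 A = {e \<in> A. card e = 2}"

definition transversal_gen :: "'n::linorder set set \<Rightarrow> 'n set \<Rightarrow> 'n set \<Rightarrow> 'n xypoly" where
  "transversal_gen A C D =
     (\<Prod>k\<in>C. xvar k) * (\<Prod>k\<in>D. yvar k) * (\<Prod>e\<in>part2 A. fbin (Min e) (Max e))"

definition transversal_ideal :: "'n::linorder sgraph \<Rightarrow> 'n set \<Rightarrow> 'n xypoly set" where
  "transversal_ideal G S = ideal_gen {transversal_gen A C D | A C D.
     A \<in> cut_transversals G S \<and> C \<union> D = part1 A \<and> C \<inter> D = {}}"

end

theory Submission
  imports Defs "HOL-Library.Product_Lexorder"
begin

text \<open>Grade \<open>R\<close> by the degrees in the pairs \<open>x\<^sub>i, y\<^sub>i\<close>. In a multidegree with support \<open>W\<close>, a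
  monomial is a placement of tokens on the vertices of \<open>W\<close> with capacities, and \<open>J\<^sub>G\<close> identifies
  two placements that differ by moving a token along an edge. Tokens can travel along any path in
  \<open>W\<close>, so the classes are given by the number of tokens on each component of the induced
  subgraph, which is also what \<open>P\<^sub>S\<close> with \<open>S\<close> the complement of \<open>W\<close> records. Hence \<open>J\<^sub>G\<close> is
  the intersection of all \<open>P\<^sub>S\<close>, and it suffices to intersect over minimal cuts. The \<open>P\<^sub>S\<close> are
  kernels of homomorphisms into a domain, hence prime.

  A transversal \<open>A\<close> gives a product \<open>g\<close> of non-elements of \<open>P\<^sub>S\<close> lying in every other minimal
  prime, so \<open>(J\<^sub>G : g) = P\<^sub>S\<close>. Conversely, if \<open>(J\<^sub>G : h) = P\<^sub>S\<close> then \<open>h\<close> lies in all minimal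
  primes but \<open>P\<^sub>S\<close>, so a power of \<open>h\<close> lies in their product, which is contained in
  \<open>J\<^sub>G\<close> plus the transversal ideal. If this sum is radical, it contains \<open>h\<close>, and \<open>h\<close> cannot
  have smaller degree than the generators of the transversal ideal, as \<open>h\<close> is not in \<open>P\<^sub>S\<close>.\<close>

abbreviation coef :: "('a \<Rightarrow>\<^sub>0 'b::zero) \<Rightarrow> 'a \<Rightarrow> 'b" where "coef \<equiv> Poly_Mapping.lookup"
abbreviation mon :: "'a \<Rightarrow> ('a \<Rightarrow>\<^sub>0 'b::zero_neq_one)" where "mon m \<equiv> Poly_Mapping.single m 1"

section \<open>Ideals\<close>

definition is_ideal :: "'a::comm_ring_1 set \<Rightarrow> bool" where
  "is_ideal I \<longleftrightarrow> module.subspace (*) I"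

lemma is_ideal_iff:
  "is_ideal I \<longleftrightarrow> 0 \<in> I \<and> (\<forall>a\<in>I. \<forall>b\<in>I. a + b \<in> I) \<and> (\<forall>c. \<forall>a\<in>I. c * a \<in> I)"
  by (simp add: is_ideal_def module.subspace_def[OF module_times])

lemma is_idealI:
  assumes "0 \<in> I" "\<And>a b. a \<in> I \<Longrightarrow> b \<in> I \<Longrightarrow> a + b \<in> I" "\<And>c a. a \<in> I \<Longrightarrow> c * a \<in> I"
  shows "is_ideal I"
  using assms by (simp add: is_ideal_iff)

lemma is_ideal_zero: "is_ideal I \<Longrightarrow> 0 \<in> I"
  and is_ideal_add: "is_ideal I \<Longrightarrow> a \<in> I \<Longrightarrow> b \<in> I \<Longrightarrow> a + b \<in> I"
  and is_ideal_mult: "is_ideal I \<Longrightarrow> a \<in> I \<Longrightarrow> c * a \<in> I"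
  by (simp_all add: is_ideal_iff)

lemma is_ideal_uminus: "is_ideal I \<Longrightarrow> a \<in> I \<Longrightarrow> - a \<in> I"
  using is_ideal_mult[of I a "-1"] by simp

lemma is_ideal_sum: "is_ideal I \<Longrightarrow> (\<And>x. x \<in> A \<Longrightarrow> f x \<in> I) \<Longrightarrow> sum f A \<in> I"
  unfolding is_ideal_def by (rule module.subspace_sum[OF module_times])

lemma is_ideal_dvd: "is_ideal I \<Longrightarrow> a \<in> I \<Longrightarrow> a dvd b \<Longrightarrow> b \<in> I"
  by (metis dvdE is_ideal_mult mult.commute)

lemma is_ideal_gen: "is_ideal (ideal_gen B)"
  unfolding is_ideal_def ideal_gen_def by (rule module.subspace_span[OF module_times])

lemma ideal_gen_base: "b \<in> B \<Longrightarrow> b \<in> ideal_gen B"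
  unfolding ideal_gen_def by (rule module.span_base[OF module_times])

lemma ideal_gen_minimal: "B \<subseteq> I \<Longrightarrow> is_ideal I \<Longrightarrow> ideal_gen B \<subseteq> I"
  unfolding ideal_gen_def is_ideal_def by (rule module.span_minimal[OF module_times])

lemma is_ideal_plus:
  assumes "is_ideal I" "is_ideal J"
  shows "is_ideal (I + J)"
proof (rule is_idealI)
  show "0 \<in> I + J"
    using set_plus_intro[of 0 I 0 J] assms by (simp add: is_ideal_zero)
next
  fix a b assume "a \<in> I + J" "b \<in> I + J"
  then obtain x y x' y' where "x \<in> I" "y \<in> J" "x' \<in> I" "y' \<in> J" "a = x + y" "b = x' + y'"
    by (auto elim!: set_plus_elim)
  then show "a + b \<in> I + J"
    using set_plus_intro[of "x + x'" I "y + y'" J] assms by (simp add: is_ideal_add algebra_simps)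
next
  fix c a assume "a \<in> I + J"
  then obtain x y where "x \<in> I" "y \<in> J" "a = x + y"
    by (auto elim!: set_plus_elim)
  then show "c * a \<in> I + J"
    using set_plus_intro[of "c * x" I "c * y" J] assms by (simp add: is_ideal_mult distrib_left)
qed

lemma ideal_plus_left: "is_ideal J \<Longrightarrow> I \<subseteq> I + J"
  using is_ideal_zero set_zero_plus2[of J I] by (metis add.commute)

lemma ideal_plus_right: "is_ideal I \<Longrightarrow> J \<subseteq> I + J"
  using is_ideal_zero set_zero_plus2[of I J] by metis

lemma ideal_plus_least: "is_ideal K \<Longrightarrow> I \<subseteq> K \<Longrightarrow> J \<subseteq> K \<Longrightarrow> I + J \<subseteq> K"
  by (auto elim!: set_plus_elim intro!: is_ideal_add)

text \<open>The sum is the elementwise sum of sets, with \<open>{0}\<close> as empty case. One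
  induction carries all three claims, since each step needs the partial sum to be an ideal.\<close>

lemma ideal_set_sum:
  assumes "finite A" "\<And>x. x \<in> A \<Longrightarrow> is_ideal (F x)"
  shows "is_ideal (\<Sum>x\<in>A. F x)" "\<And>x. x \<in> A \<Longrightarrow> F x \<subseteq> (\<Sum>x\<in>A. F x)"
    "\<And>K. is_ideal K \<Longrightarrow> (\<And>x. x \<in> A \<Longrightarrow> F x \<subseteq> K) \<Longrightarrow> (\<Sum>x\<in>A. F x) \<subseteq> K"
proof -
  have "is_ideal (\<Sum>x\<in>A. F x) \<and> (\<forall>x\<in>A. F x \<subseteq> (\<Sum>x\<in>A. F x)) \<and>
    (\<forall>K. is_ideal K \<longrightarrow> (\<forall>x\<in>A. F x \<subseteq> K) \<longrightarrow> (\<Sum>x\<in>A. F x) \<subseteq> K)"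
    using assms
  proof (induction A rule: finite_induct)
    case empty
    show ?case by (auto simp: is_ideal_iff)
  next
    case (insert x A)
    have *: "is_ideal (F x)" "is_ideal (\<Sum>x\<in>A. F x)"
      using insert by auto
    show ?case
      using insert * is_ideal_plus[OF *] ideal_plus_left[OF *(2), of "F x"]
        ideal_plus_right[OF *(1), of "\<Sum>x\<in>A. F x"]
      by (simp add: ideal_plus_least) blast
  qed
  then show "is_ideal (\<Sum>x\<in>A. F x)" "\<And>x. x \<in> A \<Longrightarrow> F x \<subseteq> (\<Sum>x\<in>A. F x)"
    "\<And>K. is_ideal K \<Longrightarrow> (\<And>x. x \<in> A \<Longrightarrow> F x \<subseteq> K) \<Longrightarrow> (\<Sum>x\<in>A. F x) \<subseteq> K"
    by blast+
qed

text \<open>A product of ideals is generated by the products of generators and contains the matching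
  power of any common element. \<open>K\<close> is any ideal containing those products and varies in
  the induction.\<close>

lemma power_card_mem_product_ideal:
  fixes h :: "'a::comm_ring_1"
  assumes "finite F" "\<And>x. x \<in> F \<Longrightarrow> h \<in> ideal_gen (B x)" "is_ideal K"
    and prod: "\<And>\<gamma>. (\<And>x. x \<in> F \<Longrightarrow> \<gamma> x \<in> B x) \<Longrightarrow> (\<Prod>x\<in>F. \<gamma> x) \<in> K"
  shows "h ^ card F \<in> K"
  using assms(1,2,3) prod
proof (induction F arbitrary: K rule: finite_induct)
  case empty
  then show ?case by simp
next
  case (insert x F)
  \<comment> \<open>The induction hypothesis is applied to the colon of \<open>K\<close> by the
    ideal of \<open>x\<close>; \<open>h\<close> itself then supplies the last factor.\<close>
  have "h ^ card F \<in> {q. \<forall>a\<in>ideal_gen (B x). q * a \<in> K}" (is "_ \<in> ?L")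
  proof (rule insert.IH)
    show "is_ideal ?L"
      using insert.prems(2) by (auto simp: is_ideal_iff algebra_simps)
  next
    fix \<gamma> assume \<gamma>: "\<And>y. y \<in> F \<Longrightarrow> \<gamma> y \<in> B y"
    have "ideal_gen (B x) \<subseteq> {a. (\<Prod>y\<in>F. \<gamma> y) * a \<in> K}"
    proof (rule ideal_gen_minimal)
      show "is_ideal {a. (\<Prod>y\<in>F. \<gamma> y) * a \<in> K}"
        using insert.prems(2) by (auto simp: is_ideal_iff algebra_simps mult.left_commute)
      show "B x \<subseteq> {a. (\<Prod>y\<in>F. \<gamma> y) * a \<in> K}"
      proof
        fix a assume "a \<in> B x"
        then have "(\<Prod>y\<in>insert x F. (\<gamma>(x := a)) y) \<in> K"
          using \<gamma> insert.hyps(2) by (intro insert.prems(3)) auto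
        moreover have "(\<Prod>y\<in>F. (\<gamma>(x := a)) y) = (\<Prod>y\<in>F. \<gamma> y)"
          using insert.hyps(2) by (intro prod.cong) auto
        ultimately show "a \<in> {a. (\<Prod>y\<in>F. \<gamma> y) * a \<in> K}"
          using insert.hyps by (simp add: mult.commute)
      qed
    qed
    then show "(\<Prod>y\<in>F. \<gamma> y) \<in> ?L" by blast
  qed (use insert.prems in auto)
  then show ?case
    using insert.prems(1) insert.hyps by (simp add: mult.commute)
qed

section \<open>Pushing polynomials forward along a map of monomials\<close>

text \<open>The linear extension of \<open>\<psi>\<close> that kills the monomials in
  \<open>Z\<close>; coefficients add up along the fibres of \<open>\<psi>\<close>.\<close>

definition push :: "('m \<Rightarrow> 'k) \<Rightarrow> 'm set \<Rightarrow> ('m \<Rightarrow>\<^sub>0 'c::comm_monoid_add) \<Rightarrow> ('k \<Rightarrow>\<^sub>0 'c)" where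
  "push \<psi> Z p = (\<Sum>m\<in>Poly_Mapping.keys p - Z. Poly_Mapping.single (\<psi> m) (coef p m))"

lemma push_eq_sum:
  assumes "finite A" "Poly_Mapping.keys p \<subseteq> A"
  shows "push \<psi> Z p = (\<Sum>m\<in>A - Z. Poly_Mapping.single (\<psi> m) (coef p m))"
  unfolding push_def using assms
  by (intro sum.mono_neutral_left) (auto simp: in_keys_iff)

lemma push_zero [simp]: "push \<psi> Z 0 = 0"
  by (simp add: push_def)

lemma push_add: "push \<psi> Z (p + q) = push \<psi> Z p + push \<psi> Z q"
proof -
  let ?A = "Poly_Mapping.keys p \<union> Poly_Mapping.keys q"
  have "push \<psi> Z (p + q) = (\<Sum>m\<in>?A - Z. Poly_Mapping.single (\<psi> m) (coef (p + q) m))"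
    by (rule push_eq_sum) (auto dest: subsetD[OF Poly_Mapping.keys_add])
  also have "\<dots> = push \<psi> Z p + push \<psi> Z q"
    by (subst (1 2) push_eq_sum[of ?A]) (auto simp: lookup_add single_add sum.distrib)
  finally show ?thesis .
qed

lemma push_sum: "push \<psi> Z (\<Sum>x\<in>A. f x) = (\<Sum>x\<in>A. push \<psi> Z (f x))"
  by (induction A rule: infinite_finite_induct) (auto simp: push_add)

lemma push_diff: "push \<psi> Z (p - q) = push \<psi> Z p - push \<psi> Z (q :: _ \<Rightarrow>\<^sub>0 'c::ab_group_add)"
  using push_add[of \<psi> Z "p - q" q] by simp

lemma push_single:
  "push \<psi> Z (Poly_Mapping.single m c) = (if m \<in> Z then 0 else Poly_Mapping.single (\<psi> m) c)"
  by (cases "m \<in> Z") (auto simp: push_eq_sum[of "{m}"] insert_Diff_if)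

lemma coef_push: "coef (push \<psi> Z p) k = (\<Sum>m\<in>{m\<in>Poly_Mapping.keys p. m \<notin> Z \<and> \<psi> m = k}. coef p m)"
proof -
  have "coef (push \<psi> Z p) k = (\<Sum>m\<in>Poly_Mapping.keys p - Z. if \<psi> m = k then coef p m else 0)"
    unfolding push_def lookup_sum by (intro sum.cong) (auto simp: lookup_single when_def)
  also have "\<dots> = (\<Sum>m\<in>{m\<in>Poly_Mapping.keys p - Z. \<psi> m = k}. coef p m)"
    by (rule sum.inter_filter[symmetric]) auto
  also have "{m\<in>Poly_Mapping.keys p - Z. \<psi> m = k} = {m\<in>Poly_Mapping.keys p. m \<notin> Z \<and> \<psi> m = k}"
    by auto
  finally show ?thesis .
qed

lemma keys_push: "Poly_Mapping.keys (push \<psi> Z p) \<subseteq> \<psi> ` Poly_Mapping.keys p"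
proof
  fix k assume "k \<in> Poly_Mapping.keys (push \<psi> Z p)"
  then have "{m\<in>Poly_Mapping.keys p. m \<notin> Z \<and> \<psi> m = k} \<noteq> {}"
    unfolding in_keys_iff coef_push using sum.empty by metis
  then show "k \<in> \<psi> ` Poly_Mapping.keys p"
    by blast
qed

lemma poly_mapping_eq_sum_single:
  "p = (\<Sum>m\<in>Poly_Mapping.keys p. Poly_Mapping.single m (coef p m))"
proof (rule poly_mapping_eqI)
  fix k
  have "coef (\<Sum>m\<in>Poly_Mapping.keys p. Poly_Mapping.single m (coef p m)) k =
      (\<Sum>m\<in>Poly_Mapping.keys p. if m = k then coef p m else 0)"
    unfolding lookup_sum by (intro sum.cong) (auto simp: lookup_single when_def)
  then show "coef p k = coef (\<Sum>m\<in>Poly_Mapping.keys p. Poly_Mapping.single m (coef p m)) k"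
    by (simp add: in_keys_iff)
qed

text \<open>By bilinearity only single terms matter. The condition on \<open>Z\<close> says that a
  product of monomials is killed exactly when a factor is.\<close>

lemma push_mult:
  fixes p q :: "'m::comm_monoid_add \<Rightarrow>\<^sub>0 'c::comm_ring_1" and \<psi> :: "'m \<Rightarrow> 'k::comm_monoid_add"
  assumes \<psi>: "\<And>a b. \<psi> (a + b) = \<psi> a + \<psi> b" and Z: "\<And>a b. a + b \<in> Z \<longleftrightarrow> a \<in> Z \<or> b \<in> Z"
  shows "push \<psi> Z (p * q) = push \<psi> Z p * push \<psi> Z q"
proof -
  let ?s = "\<lambda>p m. Poly_Mapping.single m (coef p m)"
  have "push \<psi> Z (p * q) = push \<psi> Z (\<Sum>a\<in>Poly_Mapping.keys p. \<Sum>b\<in>Poly_Mapping.keys q. ?s p a * ?s q b)"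
    by (subst poly_mapping_eq_sum_single[of p], subst poly_mapping_eq_sum_single[of q])
      (simp only: sum_product)
  also have "\<dots> = (\<Sum>a\<in>Poly_Mapping.keys p. \<Sum>b\<in>Poly_Mapping.keys q. push \<psi> Z (?s p a) * push \<psi> Z (?s q b))"
    unfolding push_sum by (intro sum.cong refl) (simp add: mult_single push_single \<psi> Z)
  also have "\<dots> = push \<psi> Z (\<Sum>a\<in>Poly_Mapping.keys p. ?s p a) * push \<psi> Z (\<Sum>b\<in>Poly_Mapping.keys q. ?s q b)"
    by (simp only: push_sum sum_product)
  finally show ?thesis
    by (simp only: poly_mapping_eq_sum_single[symmetric])
qed

text \<open>Modulo \<open>I\<close> every monomial outside \<open>Z\<close> equals a chosen
  representative of its fibre, and the coefficients of \<open>p\<close> over each fibre sum to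
  zero.\<close>

lemma mem_ideal_if_push_eq_zero:
  fixes I :: "('m::comm_monoid_add \<Rightarrow>\<^sub>0 'c::comm_ring_1) set"
  assumes I: "is_ideal I" and Z: "\<And>m. m \<in> Z \<Longrightarrow> mon m \<in> I"
    and \<psi>: "\<And>m m'. m \<notin> Z \<Longrightarrow> m' \<notin> Z \<Longrightarrow> \<psi> m = \<psi> m' \<Longrightarrow> mon m - mon m' \<in> I"
    and p: "push \<psi> Z p = 0"
  shows "p \<in> I"
proof -
  define \<rho> where "\<rho> k = (SOME m. m \<notin> Z \<and> \<psi> m = k)" for k
  have \<rho>: "\<rho> (\<psi> m) \<notin> Z \<and> \<psi> (\<rho> (\<psi> m)) = \<psi> m" if "m \<notin> Z" for m
    unfolding \<rho>_def by (rule someI[of _ m]) (use that in auto)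
  \<comment> \<open>Pushing 0 along \<open>\<rho>\<close> shows that the sum with monomials replaced
    by representatives vanishes, so it may be subtracted below.\<close>
  have "push \<rho> {} (push \<psi> Z p) = (\<Sum>m\<in>Poly_Mapping.keys p - Z. Poly_Mapping.single (\<rho> (\<psi> m)) (coef p m))"
    unfolding push_def[of \<psi>] push_sum by (simp add: push_single)
  then have q: "(\<Sum>m\<in>Poly_Mapping.keys p - Z. Poly_Mapping.single (\<rho> (\<psi> m)) (coef p m)) = 0"
    by (simp add: p)
  have "p = (\<Sum>m\<in>Poly_Mapping.keys p. Poly_Mapping.single m (coef p m))"
    by (rule poly_mapping_eq_sum_single)
  also have "\<dots> = (\<Sum>m\<in>Poly_Mapping.keys p \<inter> Z. Poly_Mapping.single m (coef p m)) +
      (\<Sum>m\<in>Poly_Mapping.keys p - Z. Poly_Mapping.single m (coef p m))"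
    by (rule sum.Int_Diff) simp
  also have "(\<Sum>m\<in>Poly_Mapping.keys p - Z. Poly_Mapping.single m (coef p m)) =
      (\<Sum>m\<in>Poly_Mapping.keys p - Z. Poly_Mapping.single 0 (coef p m) * (mon m - mon (\<rho> (\<psi> m))))"
    using q by (simp add: right_diff_distrib mult_single sum_subtractf)
  finally have eq: "p = (\<Sum>m\<in>Poly_Mapping.keys p \<inter> Z. Poly_Mapping.single 0 (coef p m) * mon m) + \<dots>"
    by (simp add: mult_single)
  show ?thesis
    by (subst eq, intro is_ideal_add[OF I] is_ideal_sum[OF I] is_ideal_mult[OF I])
      (use Z \<psi> \<rho> in auto)
qed

section \<open>Monomials in the variables x and y\<close>

lemma mon_neq_zero [simp]: "mon m \<noteq> 0"
  by (simp flip: keys_eq_empty)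

definition vdeg :: "'n mono \<Rightarrow> 'n \<Rightarrow> nat" where
  "vdeg m i = coef m (False, i) + coef m (True, i)"

definition vsupp :: "'n mono \<Rightarrow> 'n set" where
  "vsupp m = {i. vdeg m i \<noteq> 0}"

lemma vdeg_add [simp]: "vdeg (a + b) i = vdeg a i + vdeg b i"
  by (simp add: vdeg_def lookup_add)

lemma vdeg_single [simp]: "vdeg (Poly_Mapping.single (b, j) k) i = (if i = j then k else 0)"
  by (cases b) (auto simp: vdeg_def lookup_single)

lemma vsupp_add [simp]: "vsupp (a + b) = vsupp a \<union> vsupp b"
  by (auto simp: vsupp_def)

lemma vsupp_single [simp]: "vsupp (Poly_Mapping.single (b, j) k) = (if k = 0 then {} else {j})"
  by (auto simp: vsupp_def)

lemma mono_degree_eq_sum_vdeg: "mono_degree m = (\<Sum>i\<in>UNIV. vdeg m (i :: 'n::finite))"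
proof -
  have "mono_degree m = (\<Sum>v\<in>UNIV. coef m v)"
    unfolding mono_degree_def by (intro sum.mono_neutral_left) (auto simp: in_keys_iff)
  also have "\<dots> = (\<Sum>b\<in>UNIV. \<Sum>i\<in>UNIV. coef m (b, i))"
    by (simp add: sum.cartesian_product)
  also have "\<dots> = (\<Sum>i\<in>UNIV. vdeg m i)"
    by (simp add: UNIV_bool vdeg_def sum.distrib)
  finally show ?thesis .
qed

lemma mono_degree_add: "mono_degree (a + b) = mono_degree a + mono_degree (b :: 'n::finite mono)"
  by (simp add: mono_degree_eq_sum_vdeg sum.distrib)

lemma mono_eq_add_single:
  fixes m :: "'n mono"
  assumes "coef m v > 0"
  obtains r where "m = r + Poly_Mapping.single v 1"
proof
  show "m = (m - Poly_Mapping.single v 1) + Poly_Mapping.single v 1"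
    using assms by (intro poly_mapping_eqI) (auto simp: lookup_add lookup_minus lookup_single when_def)
qed

text \<open>The entry at \<open>(False, i)\<close> is the degree in the pair \<open>x\<^sub>i, y\<^sub>i\<close>, and the entry at
  \<open>(True, k)\<close> is the total \<open>x\<close>-degree of the class \<open>k\<close>: this is the exponent of the image of \<open>m\<close>
  under \<open>x\<^sub>i \<mapsto> t\<^sub>i u\<^sub>c\<^sub>(\<^sub>i\<^sub>)\<close>, \<open>y\<^sub>i \<mapsto> t\<^sub>i\<close>.\<close>

definition shape :: "('n::finite \<Rightarrow> 'n) \<Rightarrow> 'n mono \<Rightarrow> 'n mono" where
  "shape c m = Abs_poly_mapping
     (\<lambda>(b, k). if b then \<Sum>j\<in>{j. c j = k}. coef m (False, j) else vdeg m k)"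

lemma coef_shape:
  "coef (shape c m) (b, k) = (if b then \<Sum>j\<in>{j. c j = k}. coef m (False, j) else vdeg m k)"
  unfolding shape_def by (subst lookup_Abs_poly_mapping) auto

lemma shape_add: "shape c (a + b) = shape c a + shape c b"
  by (rule poly_mapping_eqI) (auto simp: coef_shape lookup_add sum.distrib)

lemma shape_x: "shape c (Poly_Mapping.single (False, i) d) =
    Poly_Mapping.single (False, i) d + Poly_Mapping.single (True, c i) d"
proof (rule poly_mapping_eqI)
  fix v
  show "coef (shape c (Poly_Mapping.single (False, i) d)) v =
      coef (Poly_Mapping.single (False, i) d + Poly_Mapping.single (True, c i) d) v"
    by (cases v) (auto simp: coef_shape lookup_add lookup_single when_def)
qed

lemma shape_y: "shape c (Poly_Mapping.single (True, i) d) = Poly_Mapping.single (False, i) d"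
proof (rule poly_mapping_eqI)
  fix v
  show "coef (shape c (Poly_Mapping.single (True, i) d)) v = coef (Poly_Mapping.single (False, i) d) v"
    by (cases v) (auto simp: coef_shape lookup_single when_def)
qed

lemma vdeg_eq_if_shape_eq: "shape c m = shape c' m' \<Longrightarrow> vdeg m = vdeg m'"
proof
  fix i assume "shape c m = shape c' m'"
  then show "vdeg m i = vdeg m' i"
    using coef_shape[of c m False i] coef_shape[of c' m' False i] by simp
qed

lemma vsupp_eq_if_shape_eq: "shape c m = shape c' m' \<Longrightarrow> vsupp m = vsupp m'"
  by (drule vdeg_eq_if_shape_eq) (simp add: vsupp_def)

lemma fbin_eq: "fbin i j = mon (Poly_Mapping.single (False, i) 1 + Poly_Mapping.single (True, j) 1)
    - mon (Poly_Mapping.single (False, j) 1 + Poly_Mapping.single (True, i) 1)"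
  by (simp add: fbin_def xvar_def yvar_def mult_single)

lemma fbin_self [simp]: "fbin i i = 0"
  by (simp add: fbin_def)

lemma fbin_swap: "fbin j i = - fbin i j"
  by (simp add: fbin_def)

text \<open>Used in contrapositive form: if the sums over a fibre agree, an excess at one point
  forces a deficit at another point of the same fibre.\<close>

lemma sum_fibre_less:
  fixes f g :: "'n::finite \<Rightarrow> nat"
  assumes "\<And>j. c j = c i \<Longrightarrow> f j \<le> g j" "f i < g i"
  shows "(\<Sum>j\<in>{j. c j = c i}. f j) < (\<Sum>j\<in>{j. c j = c i}. g j)"
  using assms by (intro sum_strict_mono_ex1) auto

text \<open>Think of the \<open>x\<close>-degrees as tokens on the vertices: multiplying a binomial
  \<open>f\<^sub>i\<^sub>j\<close> by a monomial moves one token from \<open>i\<close> to \<open>j\<close>, and such moves connect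
  any two configurations of the same shape.\<close>

lemma mon_diff_mem_if_shape_eq:
  fixes m m' :: "'n::finite mono"
  assumes I: "is_ideal I"
    and move: "\<And>r i j. vsupp r \<union> {i, j} = W \<Longrightarrow> c i = c j \<Longrightarrow> mon r * fbin i j \<in> I"
    and "shape c m = shape c m'" "vsupp m = W"
  shows "mon m - mon m' \<in> I"
  using assms(3,4)
\<comment> \<open>The measure counts the tokens of \<open>m\<close> in excess of \<open>m'\<close>;
  truncated subtraction discards the deficits.\<close>
proof (induction "\<Sum>i\<in>UNIV. coef m (False, i) - coef m' (False, i)" arbitrary: m rule: less_induct)
  case less
  have tot: "(\<Sum>j\<in>{j. c j = k}. coef m (False, j)) = (\<Sum>j\<in>{j. c j = k}. coef m' (False, j))" for k
    using coef_shape[of c m True k] coef_shape[of c m' True k] less.prems(1) by simp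
  have vd: "vdeg m i = vdeg m' i" for i
    using vdeg_eq_if_shape_eq[OF less.prems(1)] by simp
  show ?case
  proof (cases "\<exists>i. coef m' (False, i) < coef m (False, i)")
    case True
    then obtain i where i: "coef m' (False, i) < coef m (False, i)" by blast
    obtain j where j: "c j = c i" "coef m (False, j) < coef m' (False, j)"
      using sum_fibre_less[of c i "\<lambda>j. coef m' (False, j)" "\<lambda>j. coef m (False, j)"] i tot[of "c i"]
      by (metis less_irrefl not_le_imp_less)
    have ij: "i \<noteq> j" using i j by auto
    \<comment> \<open>The capacity at \<open>j\<close> is the same in \<open>m\<close> and
      \<open>m'\<close>, so too few x-tokens there leave a factor y_j to exchange.\<close>
    have "coef m (True, j) > 0"
      using vd[of j] j by (simp add: vdeg_def)
    then obtain s where s: "m = s + Poly_Mapping.single (True, j) 1"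
      by (rule mono_eq_add_single)
    have "coef s (False, i) > 0"
      using i by (simp add: s lookup_add lookup_single)
    then obtain r where r: "s = r + Poly_Mapping.single (False, i) 1"
      by (rule mono_eq_add_single)
    define n where "n = r + Poly_Mapping.single (False, j) 1 + Poly_Mapping.single (True, i) 1"
    have m: "m = r + Poly_Mapping.single (False, i) 1 + Poly_Mapping.single (True, j) 1"
      using s r by simp
    have "mon m - mon n = mon r * fbin i j"
      by (simp add: m n_def fbin_eq right_diff_distrib mult_single add.assoc)
    moreover have W: "vsupp r \<union> {i, j} = W"
      using less.prems(2) by (auto simp: m)
    ultimately have 1: "mon m - mon n \<in> I"
      using move j by simp
    have 2: "mon n - mon m' \<in> I"
    proof (rule less.hyps)
      show "(\<Sum>k\<in>UNIV. coef n (False, k) - coef m' (False, k))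
          < (\<Sum>k\<in>UNIV. coef m (False, k) - coef m' (False, k))"
      proof (rule sum_strict_mono_ex1)
        have n: "coef n (False, k) = (if k = i then coef m (False, k) - 1
            else if k = j then coef m (False, k) + 1 else coef m (False, k))" for k
          using ij by (auto simp: m n_def lookup_add lookup_single when_def)
        show "\<forall>k\<in>UNIV. coef n (False, k) - coef m' (False, k) \<le> coef m (False, k) - coef m' (False, k)"
          using j by (auto simp: n)
        show "\<exists>k\<in>UNIV. coef n (False, k) - coef m' (False, k) < coef m (False, k) - coef m' (False, k)"
          using i by (intro bexI[of _ i]) (auto simp: n)
      qed simp
      show "shape c n = shape c m'"
        using less.prems(1) j by (simp add: m n_def shape_add shape_x shape_y ac_simps)
      show "vsupp n = W"
        using W by (auto simp: n_def)
    qed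
    have "(mon m - mon n) + (mon n - mon m') \<in> I"
      by (rule is_ideal_add[OF I 1 2])
    then show ?thesis by simp
  next
    case False
    \<comment> \<open>Without any excess, equal sums over the fibres force equal x-degrees; the
      y-degrees follow from the capacities.\<close>
    then have le: "coef m (False, i) \<le> coef m' (False, i)" for i
      using not_le by blast
    have x: "coef m (False, i) = coef m' (False, i)" for i
      using sum_fibre_less[of c i "\<lambda>j. coef m (False, j)" "\<lambda>j. coef m' (False, j)"] le tot[of "c i"]
      by (metis le_neq_implies_less less_irrefl)
    moreover have "coef m (True, i) = coef m' (True, i)" for i
      using vd[of i] x[of i] by (simp add: vdeg_def)
    ultimately have "m = m'"
      by (intro poly_mapping_eqI) (metis (full_types) surj_pair)
    then show ?thesis
      by (simp add: is_ideal_zero[OF I])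
  qed
qed

section \<open>Binomial edge ideals and cut primes\<close>

locale full_graph =
  fixes G :: "'n::{finite,linorder} sgraph"
  assumes verts: "verts G = UNIV"
begin

section \<open>Connectivity after deleting a set of vertices\<close>

definition linked :: "'n set \<Rightarrow> ('n \<times> 'n) set" where
  "linked S = {(u, v). u \<notin> S \<and> v \<notin> S \<and> (u, v) \<in> {(a, b). {a, b} \<in> edges G \<and> a \<notin> S \<and> b \<notin> S}\<^sup>*}"

lemma equiv_linked: "equiv (- S) (linked S)"
proof (rule equivI)
  have "sym {(a, b). {a, b} \<in> edges G \<and> a \<notin> S \<and> b \<notin> S}"
    by (auto simp: sym_def insert_commute)
  note symD[OF sym_rtrancl[OF this]]
  then show "sym (linked S)"
    unfolding linked_def by (intro symI) blast
qed (auto simp: linked_def refl_on_def trans_def)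

lemma linked_refl: "i \<notin> S \<Longrightarrow> (i, i) \<in> linked S"
  by (simp add: linked_def)

lemma linked_sym: "(i, j) \<in> linked S \<Longrightarrow> (j, i) \<in> linked S"
  using equiv_linked by (meson equivE symD)

lemma linked_trans: "(i, j) \<in> linked S \<Longrightarrow> (j, k) \<in> linked S \<Longrightarrow> (i, k) \<in> linked S"
  using equiv_linked by (meson equivE transD)

lemma linked_edge: "{i, j} \<in> edges G \<Longrightarrow> i \<notin> S \<Longrightarrow> j \<notin> S \<Longrightarrow> (i, j) \<in> linked S"
  by (auto simp: linked_def)

lemma linked_notin: "(i, j) \<in> linked S \<Longrightarrow> i \<notin> S \<and> j \<notin> S"
  by (simp add: linked_def)

lemma components_induced: "components (induced G (- S)) = (- S) // linked S"
proof -
  have "{(a, b). {a, b} \<in> edges (induced G (- S))} = {(a, b). {a, b} \<in> edges G \<and> a \<notin> S \<and> b \<notin> S}"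
    by (auto simp: induced_def)
  then show ?thesis
    by (simp add: components_def linked_def induced_def)
qed

lemma verts_diff: "verts G - S = - S"
  by (auto simp: verts)

text \<open>The least vertex names its component, so that components can index the variables
  \<open>(True, k)\<close> in \<open>shape\<close>. For vertices of \<open>S\<close> the class is
  empty and the minimum unspecified.\<close>

definition cls :: "'n set \<Rightarrow> 'n \<Rightarrow> 'n" where
  "cls S i = Min (linked S `` {i})"

lemma cls_eq_iff:
  assumes "i \<notin> S" "j \<notin> S"
  shows "cls S i = cls S j \<longleftrightarrow> (i, j) \<in> linked S"
proof
  have mem: "(k, cls S k) \<in> linked S" if "k \<notin> S" for k
    using Min_in[of "linked S `` {k}"] linked_refl[OF that] by (auto simp: cls_def)
  assume "cls S i = cls S j"
  then show "(i, j) \<in> linked S"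
    using mem assms linked_sym linked_trans by metis
next
  assume "(i, j) \<in> linked S"
  then have "linked S `` {i} = linked S `` {j}"
    using equiv_class_eq[OF equiv_linked] by blast
  then show "cls S i = cls S j"
    by (simp add: cls_def)
qed

subsection \<open>Cut primes as kernels\<close>

text \<open>Writing t_i and u_k for the variables \<open>(False, i)\<close> and
  \<open>(True, k)\<close> of the target, this maps x_i to t_i u_c(i) and y_i to t_i for i outside
  \<open>S\<close>, and both to 0 for i in \<open>S\<close>.\<close>

definition cut_hom :: "'n set \<Rightarrow> 'n xypoly \<Rightarrow> 'n xypoly" where
  "cut_hom S = push (shape (cls S)) {m. vsupp m \<inter> S \<noteq> {}}"

lemma cut_hom_mult: "cut_hom S (p * q) = cut_hom S p * cut_hom S q"
  unfolding cut_hom_def by (rule push_mult) (auto simp: shape_add)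

lemma cut_hom_mon: "vsupp m \<inter> S = {} \<Longrightarrow> cut_hom S (mon m) = mon (shape (cls S) m)"
  by (simp add: cut_hom_def push_single)

lemma cut_hom_x: "cut_hom S (xvar i) = 0 \<longleftrightarrow> i \<in> S"
  and cut_hom_y: "cut_hom S (yvar i) = 0 \<longleftrightarrow> i \<in> S"
  by (simp_all add: cut_hom_def xvar_def yvar_def push_single)

text \<open>Outside \<open>S\<close> the image is t_i t_j (u_c(i) - u_c(j)), which vanishes exactly
  when the classes agree.\<close>

lemma cut_hom_fbin:
  "cut_hom S (fbin i j) = 0 \<longleftrightarrow> i \<in> S \<or> j \<in> S \<or> (i, j) \<in> linked S"
proof (cases "i \<in> S \<or> j \<in> S")
  case True
  then show ?thesis
    by (auto simp: cut_hom_def fbin_eq push_diff push_single)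
next
  case False
  let ?X = "\<lambda>i. Poly_Mapping.single (False, i) (1 :: nat)"
  let ?Y = "\<lambda>i. Poly_Mapping.single (True, i) (1 :: nat)"
  have "cut_hom S (fbin i j) = mon (?X i + ?X j + ?Y (cls S i)) - mon (?X i + ?X j + ?Y (cls S j))"
    using False by (auto simp: cut_hom_def fbin_eq push_diff push_single shape_add shape_x shape_y ac_simps)
  then have "cut_hom S (fbin i j) = 0 \<longleftrightarrow>
      (mon (?X i + ?X j + ?Y (cls S i)) :: 'n xypoly) = mon (?X i + ?X j + ?Y (cls S j))"
    by simp
  also have "\<dots> \<longleftrightarrow> cls S i = cls S j"
  proof
    assume "(mon (?X i + ?X j + ?Y (cls S i)) :: 'n xypoly) = mon (?X i + ?X j + ?Y (cls S j))"
    then have "Poly_Mapping.keys (mon (?X i + ?X j + ?Y (cls S i)) :: 'n xypoly) =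
        Poly_Mapping.keys (mon (?X i + ?X j + ?Y (cls S j)) :: 'n xypoly)" by simp
    then have "?Y (cls S i) = ?Y (cls S j)" by simp
    then have "Poly_Mapping.keys (?Y (cls S i)) = Poly_Mapping.keys (?Y (cls S j))" by simp
    then show "cls S i = cls S j" by simp
  qed simp
  also have "\<dots> \<longleftrightarrow> (i, j) \<in> linked S"
    using False cls_eq_iff by simp
  finally show ?thesis using False by simp
qed

lemma is_ideal_cut_kernel: "is_ideal {p. cut_hom S p = 0}"
  by (rule is_idealI) (auto simp: cut_hom_mult, simp_all add: cut_hom_def push_add)

text \<open>Later proofs use the cut prime only through this universal property, which trades the
  sum over components for the relation \<open>linked\<close>.\<close>

lemma
  shows is_ideal_cut_prime: "is_ideal (cut_prime G S)"
    and xvar_mem_cut_prime: "i \<in> S \<Longrightarrow> xvar i \<in> cut_prime G S"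
    and yvar_mem_cut_prime: "i \<in> S \<Longrightarrow> yvar i \<in> cut_prime G S"
    and fbin_mem_cut_prime: "(i, j) \<in> linked S \<Longrightarrow> fbin i j \<in> cut_prime G S"
    and cut_prime_least: "is_ideal K \<Longrightarrow> (\<And>i. i \<in> S \<Longrightarrow> xvar i \<in> K \<and> yvar i \<in> K) \<Longrightarrow>
      (\<And>i j. i < j \<Longrightarrow> (i, j) \<in> linked S \<Longrightarrow> fbin i j \<in> K) \<Longrightarrow> cut_prime G S \<subseteq> K"
proof -
  let ?F = "\<lambda>C. ideal_gen {fbin i j | i j. i < j \<and> i \<in> C \<and> j \<in> C}"
  let ?A = "(- S) // linked S"
  let ?V = "ideal_gen (xvar ` S \<union> yvar ` S)"
  have eq: "cut_prime G S = ?V + (\<Sum>C\<in>?A. ?F C)"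
    by (simp only: cut_prime_def verts_diff components_induced)
  note sum = ideal_set_sum[of ?A ?F, OF finite is_ideal_gen]
  show I: "is_ideal (cut_prime G S)"
    unfolding eq by (intro is_ideal_plus is_ideal_gen sum)
  have V: "?V \<subseteq> cut_prime G S"
    unfolding eq by (rule ideal_plus_left[OF sum(1)])
  have F: "?F C \<subseteq> cut_prime G S" if "C \<in> ?A" for C
    unfolding eq using ideal_plus_right[OF is_ideal_gen] sum(2)[OF that] by blast
  show "i \<in> S \<Longrightarrow> xvar i \<in> cut_prime G S" "i \<in> S \<Longrightarrow> yvar i \<in> cut_prime G S"
    using V by (auto intro!: subsetD[OF V] ideal_gen_base)
  have less: "fbin i j \<in> cut_prime G S" if "(i, j) \<in> linked S" "i < j" for i j
  proof (rule subsetD[OF F])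
    show "linked S `` {i} \<in> ?A"
      using linked_notin[OF that(1)] by (auto intro: quotientI)
    show "fbin i j \<in> ?F (linked S `` {i})"
      using that linked_refl linked_notin[OF that(1)] by (intro ideal_gen_base) blast
  qed
  \<comment> \<open>The defining generators have i < j; the reversed pair gives the negative, and i
    = j gives 0.\<close>
  show "fbin i j \<in> cut_prime G S" if "(i, j) \<in> linked S"
    using less[of i j] less[of j i] that linked_sym[OF that] is_ideal_zero[OF I]
      is_ideal_uminus[OF I, of "fbin j i"] fbin_swap[of i j]
    by (cases i j rule: linorder_cases) auto
  show "cut_prime G S \<subseteq> K"
    if K: "is_ideal K" "\<And>i. i \<in> S \<Longrightarrow> xvar i \<in> K \<and> yvar i \<in> K"
      "\<And>i j. i < j \<Longrightarrow> (i, j) \<in> linked S \<Longrightarrow> fbin i j \<in> K"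
    unfolding eq
  proof (intro ideal_plus_least sum(3) ideal_gen_minimal K(1))
    fix C assume "C \<in> ?A"
    then have "(i, j) \<in> linked S" if "i \<in> C" "j \<in> C" for i j
      using quotient_eq_iff[OF equiv_linked, of C S C i j] that by blast
    then show "{fbin i j |i j. i < j \<and> i \<in> C \<and> j \<in> C} \<subseteq> K"
      using K(3) by blast
  qed (use K(2) in auto)
qed

text \<open>The kernel is no larger than the prime: a monomial meeting \<open>S\<close> contains a
  variable of the prime, and monomials of equal shape are joined by token moves inside
  components.\<close>

lemma cut_prime_eq_kernel: "cut_prime G S = {p. cut_hom S p = 0}"
proof
  show "cut_prime G S \<subseteq> {p. cut_hom S p = 0}"
    by (rule cut_prime_least[OF is_ideal_cut_kernel]) (auto simp: cut_hom_x cut_hom_y cut_hom_fbin)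
next
  let ?P = "cut_prime G S" and ?Z = "{m. vsupp m \<inter> S \<noteq> {}}"
  note P = is_ideal_cut_prime[of S]
  show "{p. cut_hom S p = 0} \<subseteq> ?P"
  proof
    fix p assume "p \<in> {p. cut_hom S p = 0}"
    then have p: "push (shape (cls S)) ?Z p = 0"
      by (simp add: cut_hom_def)
    show "p \<in> ?P"
    proof (rule mem_ideal_if_push_eq_zero[OF P _ _ p])
      fix m :: "'n mono" assume "m \<in> ?Z"
      then obtain i where i: "i \<in> S" "vdeg m i \<noteq> 0"
        by (auto simp: vsupp_def)
      then consider "coef m (False, i) > 0" | "coef m (True, i) > 0"
        by (auto simp: vdeg_def)
      then show "mon m \<in> ?P"
      proof cases
        case 1
        then obtain r where "m = r + Poly_Mapping.single (False, i) 1"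
          by (rule mono_eq_add_single)
        then have "mon m = mon r * xvar i"
          by (simp add: xvar_def mult_single)
        then show ?thesis
          by (simp add: is_ideal_mult[OF P] xvar_mem_cut_prime i)
      next
        case 2
        then obtain r where "m = r + Poly_Mapping.single (True, i) 1"
          by (rule mono_eq_add_single)
        then have "mon m = mon r * yvar i"
          by (simp add: yvar_def mult_single)
        then show ?thesis
          by (simp add: is_ideal_mult[OF P] yvar_mem_cut_prime i)
      qed
    next
      fix m m' :: "'n mono"
      assume m: "m \<notin> ?Z" and eq: "shape (cls S) m = shape (cls S) m'"
      show "mon m - mon m' \<in> ?P"
      proof (rule mon_diff_mem_if_shape_eq[OF P _ eq refl])
        fix r :: "'n mono" and i j
        assume "vsupp r \<union> {i, j} = vsupp m" "cls S i = cls S j"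
        then show "mon r * fbin i j \<in> ?P"
          using m cls_eq_iff[of i S j] by (intro is_ideal_mult[OF P] fbin_mem_cut_prime) blast
      qed
    qed
  qed
qed

lemma mem_cut_prime_iff: "p \<in> cut_prime G S \<longleftrightarrow> cut_hom S p = 0"
  by (simp add: cut_prime_eq_kernel)

text \<open>Primality holds because the target of \<open>cut_hom\<close> has no zero divisors, its
  monomials being linearly ordered through the lexicographic order on the variables.\<close>

lemma cut_prime_mult_iff:
  "p * q \<in> cut_prime G S \<longleftrightarrow> p \<in> cut_prime G S \<or> q \<in> cut_prime G S"
  by (simp add: mem_cut_prime_iff cut_hom_mult)

lemma one_notin_cut_prime: "1 \<notin> cut_prime G S"
proof -
  have "vsupp (0 :: 'n mono) = {}" by (simp add: vsupp_def vdeg_def)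
  then have "cut_hom S (mon 0) \<noteq> 0"
    by (subst cut_hom_mon) (simp_all del: single_one)
  then show ?thesis by (simp add: mem_cut_prime_iff)
qed

lemma cut_prime_prod_iff:
  "finite A \<Longrightarrow> (\<Prod>x\<in>A. f x) \<in> cut_prime G S \<longleftrightarrow> (\<exists>x\<in>A. f x \<in> cut_prime G S)"
  by (induction A rule: finite_induct) (auto simp: cut_prime_mult_iff one_notin_cut_prime)

subsection \<open>The binomial edge ideal is the intersection of the cut primes\<close>

lemma is_ideal_binomial_edge_ideal: "is_ideal (binomial_edge_ideal G)"
  unfolding binomial_edge_ideal_def by (rule is_ideal_gen)

lemma fbin_mem_binomial_edge_ideal:
  assumes "{i, j} \<in> edges G"
  shows "fbin i j \<in> binomial_edge_ideal G"
proof -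
  have less: "fbin i j \<in> binomial_edge_ideal G" if "{i, j} \<in> edges G" "i < j" for i j
    unfolding binomial_edge_ideal_def using that by (intro ideal_gen_base) blast
  show ?thesis
    using less[of i j] less[of j i] assms is_ideal_zero[OF is_ideal_binomial_edge_ideal]
      is_ideal_uminus[OF is_ideal_binomial_edge_ideal, of "fbin j i"] fbin_swap[of i j]
    by (cases i j rule: linorder_cases) (auto simp: insert_commute)
qed

lemma binomial_edge_ideal_le_cut_prime: "binomial_edge_ideal G \<subseteq> cut_prime G S"
  unfolding binomial_edge_ideal_def
proof (rule ideal_gen_minimal[OF _ is_ideal_cut_prime])
  show "{fbin i j |i j. {i, j} \<in> edges G \<and> i < j} \<subseteq> cut_prime G S"
    by (auto simp: mem_cut_prime_iff cut_hom_fbin intro: linked_edge)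
qed

text \<open>A token can travel along a path whose vertices all lie in the support of the monomial,
  because \<open>x\<^sub>k f\<^sub>i\<^sub>j = x\<^sub>i f\<^sub>k\<^sub>j + x\<^sub>j f\<^sub>i\<^sub>k\<close>, and
  likewise for \<open>y\<^sub>k\<close>.\<close>

lemma mon_fbin_mem_if_linked:
  assumes "(i, j) \<in> linked (- W)" "vsupp r \<union> {i, j} = W"
  shows "mon r * fbin i j \<in> binomial_edge_ideal G"
proof -
  let ?J = "binomial_edge_ideal G"
  note J = is_ideal_binomial_edge_ideal
  have "(i, j) \<in> {(a, b). {a, b} \<in> edges G \<and> a \<in> W \<and> b \<in> W}\<^sup>*"
    using assms(1) by (simp add: linked_def)
  then show ?thesis
    using assms(2)
  \<comment> \<open>The path is consumed from \<open>i\<close> onwards; \<open>r\<close> varies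
    because each step alters the monomial factor.\<close>
  proof (induction arbitrary: r rule: converse_rtrancl_induct)
    case base
    show ?case by (simp add: is_ideal_zero[OF J])
  next
    case (step i k)
    then have e: "{i, k} \<in> edges G" "k \<in> W" by auto
    have ik: "fbin i k \<in> ?J" by (rule fbin_mem_binomial_edge_ideal[OF e(1)])
    consider "k = i" | "k = j" | "k \<noteq> i" "k \<noteq> j" by blast
    then show ?case
    proof cases
      case 1
      then show ?thesis using step by simp
    next
      case 2
      then show ?thesis using ik by (simp add: is_ideal_mult[OF J])
    next
      case 3
      \<comment> \<open>As \<open>k\<close> lies in \<open>W\<close> but is neither \<open>i\<close>
        nor \<open>j\<close>, it is in the support of \<open>r\<close>, so x_k or y_k divides the
        monomial.\<close>
      then have "vdeg r k \<noteq> 0"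
        using e(2) step.prems by (auto simp: vsupp_def)
      then consider "coef r (False, k) > 0" | "coef r (True, k) > 0"
        by (auto simp: vdeg_def)
      then obtain b where "coef r (b, k) > 0" by cases
      then obtain s where s: "r = s + Poly_Mapping.single (b, k) 1"
        by (rule mono_eq_add_single)
      define z :: "'n \<Rightarrow> 'n xypoly" where "z i = mon (Poly_Mapping.single (b, i) 1)" for i
      have plu: "z k * fbin i j = z i * fbin k j + z j * fbin i k"
      proof (cases b)
        case True
        then have "z = yvar" by (auto simp: z_def yvar_def)
        then show ?thesis by (simp add: fbin_def algebra_simps)
      next
        case False
        then have "z = xvar" by (auto simp: z_def xvar_def)
        then show ?thesis by (simp add: fbin_def algebra_simps)
      qed
      have "mon r * fbin i j = mon s * (z k * fbin i j)"
        by (simp add: s z_def mult_single flip: mult.assoc)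
      also have "\<dots> = (mon s * z i) * fbin k j + (mon s * z j) * fbin i k"
        by (simp add: plu algebra_simps)
      also have "mon s * z i = mon (s + Poly_Mapping.single (b, i) 1)"
        by (simp add: z_def mult_single)
      finally have eq: "mon r * fbin i j =
          mon (s + Poly_Mapping.single (b, i) 1) * fbin k j + (mon s * z j) * fbin i k" .
      \<comment> \<open>The support condition survives: \<open>k\<close> is now an endpoint of the
        binomial, and \<open>i\<close> has moved into the monomial.\<close>
      have "mon (s + Poly_Mapping.single (b, i) 1) * fbin k j \<in> ?J"
        by (rule step.IH) (use step.prems in \<open>auto simp: s\<close>)
      then show ?thesis
        unfolding eq by (intro is_ideal_add[OF J] is_ideal_mult[OF J ik])
    qed
  qed
qed

text \<open>A monomial with support \<open>W\<close> is only seen by the cut primes of sets disjoint from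
  \<open>W\<close>, and \<open>- W\<close> gives the finest information about it.\<close>

lemma binomial_edge_ideal_eq_Inter: "binomial_edge_ideal G = (\<Inter>S. cut_prime G S)"
proof
  show "binomial_edge_ideal G \<subseteq> (\<Inter>S. cut_prime G S)"
    using binomial_edge_ideal_le_cut_prime by blast
next
  show "(\<Inter>S. cut_prime G S) \<subseteq> binomial_edge_ideal G"
  proof
    fix p assume "p \<in> (\<Inter>S. cut_prime G S)"
    then have p: "cut_hom S p = 0" for S
      by (simp add: mem_cut_prime_iff)
    define \<psi> where "\<psi> m = shape (cls (- vsupp m)) m" for m :: "'n mono"
    note J = is_ideal_binomial_edge_ideal
    have "push \<psi> {} p = 0"
    proof (rule poly_mapping_eqI)
      fix k
      show "coef (push \<psi> {} p) k = coef 0 k"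
      proof (cases "\<exists>m0. \<psi> m0 = k")
        case True
        then obtain m0 where k: "k = \<psi> m0" by auto
        let ?W = "vsupp m0"
        \<comment> \<open>A shape determines the support, so the fibre of \<open>\<psi>\<close> over
          \<open>k\<close> lies in support \<open>?W\<close> and is the very fibre that
          \<open>cut_hom (- ?W)\<close> sees.\<close>
        have "m \<notin> {} \<and> \<psi> m = k \<longleftrightarrow> m \<notin> {m. vsupp m \<inter> - ?W \<noteq> {}} \<and> shape (cls (- ?W)) m = k" for m
        proof (cases "vsupp m = ?W")
          case False
          then show ?thesis
            using vsupp_eq_if_shape_eq[of _ m _ m0] by (auto simp: k \<psi>_def)
        qed (simp add: k \<psi>_def)
        then have "coef (push \<psi> {} p) k = coef (cut_hom (- ?W) p) k"
          unfolding cut_hom_def coef_push by (intro sum.cong) auto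
        then show ?thesis by (simp add: p)
      next
        case False
        then show ?thesis by (simp add: coef_push)
      qed
    qed
    then show "p \<in> binomial_edge_ideal G"
    proof (rule mem_ideal_if_push_eq_zero[OF J, rotated 2])
      fix m m' :: "'n mono" assume eq: "\<psi> m = \<psi> m'"
      then have "vsupp m = vsupp m'"
        unfolding \<psi>_def by (rule vsupp_eq_if_shape_eq)
      then have eq: "shape (cls (- vsupp m)) m = shape (cls (- vsupp m)) m'"
        using eq by (simp add: \<psi>_def)
      show "mon m - mon m' \<in> binomial_edge_ideal G"
      proof (rule mon_diff_mem_if_shape_eq[OF J _ eq refl])
        fix r :: "'n mono" and i j
        assume r: "vsupp r \<union> {i, j} = vsupp m" "cls (- vsupp m) i = cls (- vsupp m) j"
        then have "(i, j) \<in> linked (- vsupp m)"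
          using cls_eq_iff[of i "- vsupp m" j] by blast
        then show "mon r * fbin i j \<in> binomial_edge_ideal G"
          using r(1) by (rule mon_fbin_mem_if_linked)
      qed
    qed simp
  qed
qed

end

section \<open>Homogeneous polynomials\<close>

lemma homogeneous_diff: "homogeneous d p \<Longrightarrow> homogeneous d q \<Longrightarrow> homogeneous d (p - q)"
  using keys_diff[of p q] by (auto simp: homogeneous_def)

lemma homogeneous_mult:
  fixes p q :: "'n::finite xypoly"
  shows "homogeneous d p \<Longrightarrow> homogeneous e q \<Longrightarrow> homogeneous (d + e) (p * q)"
  using keys_mult[of p q] by (fastforce simp: homogeneous_def mono_degree_add)

lemma homogeneous_prod:
  fixes f :: "'a \<Rightarrow> 'n::finite xypoly"
  assumes "finite A" "\<And>x. x \<in> A \<Longrightarrow> homogeneous d (f x)"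
  shows "homogeneous (d * card A) (\<Prod>x\<in>A. f x)"
  using assms
proof (induction A rule: finite_induct)
  case empty
  show ?case by (simp add: homogeneous_def mono_degree_def)
qed (simp add: homogeneous_mult)

lemma homogeneous_xvar: "homogeneous 1 (xvar i)" and homogeneous_yvar: "homogeneous 1 (yvar i)"
  by (simp_all add: homogeneous_def xvar_def yvar_def mono_degree_def)

lemma homogeneous_fbin: "homogeneous 2 (fbin i (j :: 'n::finite))"
  unfolding fbin_def
  using homogeneous_mult[OF homogeneous_xvar homogeneous_yvar, of i j]
    homogeneous_mult[OF homogeneous_xvar homogeneous_yvar, of j i]
  by (intro homogeneous_diff) (simp_all add: numeral_2_eq_2)

lemma homogeneous_transversal_gen:
  fixes A :: "'n::{finite,linorder} set set"
  assumes "C \<union> D = part1 A" "C \<inter> D = {}"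
  shows "homogeneous (card (part1 A) + 2 * card (part2 A)) (transversal_gen A C D)"
proof -
  have "homogeneous (1 * card C + 1 * card D + 2 * card (part2 A)) (transversal_gen A C D)"
    unfolding transversal_gen_def
    by (intro homogeneous_mult homogeneous_prod homogeneous_xvar homogeneous_yvar homogeneous_fbin) simp_all
  then show ?thesis
    using card_Un_disjoint[of C D] assms by simp
qed

lemma is_ideal_min_degree:
  "is_ideal {p :: 'n::finite xypoly. \<forall>m\<in>Poly_Mapping.keys p. d \<le> mono_degree m}"
proof (rule is_idealI)
  fix p q :: "'n xypoly"
  assume "p \<in> {p. \<forall>m\<in>Poly_Mapping.keys p. d \<le> mono_degree m}"
    "q \<in> {p. \<forall>m\<in>Poly_Mapping.keys p. d \<le> mono_degree m}"
  then show "p + q \<in> {p. \<forall>m\<in>Poly_Mapping.keys p. d \<le> mono_degree m}"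
    using keys_add[of p q] by blast
next
  fix q p :: "'n xypoly"
  assume "p \<in> {p. \<forall>m\<in>Poly_Mapping.keys p. d \<le> mono_degree m}"
  then show "q * p \<in> {p. \<forall>m\<in>Poly_Mapping.keys p. d \<le> mono_degree m}"
    using keys_mult[of q p] by (fastforce simp: mono_degree_add)
qed simp

section \<open>Small dependent sets\<close>

text \<open>Generators of cut primes are indexed by small sets, so that membership in a cut prime
  becomes dependence of the index. A singleton has two generators, told apart by
  \<open>b\<close>.\<close>

definition set_gen :: "bool \<Rightarrow> 'n::linorder set \<Rightarrow> 'n xypoly" where
  "set_gen b B = (if card B = 1 then if b then yvar (Min B) else xvar (Min B)
     else fbin (Min B) (Max B))"

text \<open>Splitting \<open>part1 A\<close> in two amounts to choosing x or y at each singleton;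
  encoding this by \<open>b\<close> gives a single product over \<open>A\<close>.\<close>

lemma transversal_gen_eq_prod:
  fixes A :: "'n::{finite,linorder} set set"
  assumes "\<And>B. B \<in> A \<Longrightarrow> card B = 1 \<or> card B = 2"
  shows "transversal_gen A {k\<in>part1 A. \<not> b {k}} {k\<in>part1 A. b {k}} = (\<Prod>B\<in>A. set_gen (b B) B)"
proof -
  let ?C = "{k\<in>part1 A. \<not> b {k}}" and ?D = "{k\<in>part1 A. b {k}}"
  let ?s = "\<lambda>k :: 'n. {k}"
  have A: "A = (?s ` ?C \<union> ?s ` ?D) \<union> part2 A"
    using assms by (fastforce simp: part1_def part2_def card_1_singleton_iff)
  have disj: "(?s ` ?C \<union> ?s ` ?D) \<inter> part2 A = {}" "?s ` ?C \<inter> ?s ` ?D = {}"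
    by (auto simp: part2_def)
  have "(\<Prod>B\<in>A. set_gen (b B) B) = (\<Prod>B\<in>(?s ` ?C \<union> ?s ` ?D) \<union> part2 A. set_gen (b B) B)"
    using A by simp
  also have "\<dots> = (\<Prod>B\<in>?s ` ?C. set_gen (b B) B) * (\<Prod>B\<in>?s ` ?D. set_gen (b B) B) *
      (\<Prod>B\<in>part2 A. set_gen (b B) B)"
    using disj by (simp add: prod.union_disjoint del: Un_iff)
  also have "(\<Prod>B\<in>?s ` ?C. set_gen (b B) B) = (\<Prod>k\<in>?C. xvar k)"
    by (subst prod.reindex) (auto simp: inj_on_def set_gen_def intro!: prod.cong)
  also have "(\<Prod>B\<in>?s ` ?D. set_gen (b B) B) = (\<Prod>k\<in>?D. yvar k)"
    by (subst prod.reindex) (auto simp: inj_on_def set_gen_def intro!: prod.cong)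
  also have "(\<Prod>B\<in>part2 A. set_gen (b B) B) = (\<Prod>e\<in>part2 A. fbin (Min e) (Max e))"
    by (intro prod.cong) (auto simp: part2_def set_gen_def)
  finally show ?thesis
    by (simp add: transversal_gen_def)
qed

context full_graph
begin

lemma dependent_sets_iff:
  "B \<in> dependent_sets G S \<longleftrightarrow>
     B \<inter> S \<noteq> {} \<or> (\<exists>i\<in>B. \<exists>j\<in>B. i \<noteq> j \<and> (i, j) \<in> linked S) \<or> card B \<ge> 3"
proof -
  have "(\<exists>C\<in>(- S) // linked S. card (B \<inter> C) \<ge> 2) \<longleftrightarrow> (\<exists>i\<in>B. \<exists>j\<in>B. i \<noteq> j \<and> (i, j) \<in> linked S)"
  proof
    assume "\<exists>C\<in>(- S) // linked S. card (B \<inter> C) \<ge> 2"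
    then obtain C where C: "C \<in> (- S) // linked S" "card (B \<inter> C) \<ge> 2" by blast
    then obtain i j where "i \<in> B \<inter> C" "j \<in> B \<inter> C" "i \<noteq> j"
      using card_le_Suc0_iff_eq[of "B \<inter> C"] by fastforce
    then show "\<exists>i\<in>B. \<exists>j\<in>B. i \<noteq> j \<and> (i, j) \<in> linked S"
      using quotient_eq_iff[OF equiv_linked C(1) C(1), of i j] by blast
  next
    assume "\<exists>i\<in>B. \<exists>j\<in>B. i \<noteq> j \<and> (i, j) \<in> linked S"
    then obtain i j where ij: "i \<in> B" "j \<in> B" "i \<noteq> j" "(i, j) \<in> linked S" by blast
    then have "linked S `` {i} \<in> (- S) // linked S" "{i, j} \<subseteq> B \<inter> linked S `` {i}"
      using linked_notin[OF ij(4)] linked_refl by (auto intro: quotientI)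
    then show "\<exists>C\<in>(- S) // linked S. card (B \<inter> C) \<ge> 2"
      using card_mono[of "B \<inter> linked S `` {i}" "{i, j}"] ij(3) by (intro bexI) auto
  qed
  then show ?thesis
    by (simp add: dependent_sets_def verts_diff components_induced) (simp add: verts)
qed

text \<open>The empty set is never dependent, and sets of size at least three always are, so neither
  occurs in a difference.\<close>

lemma card_dependent_diff:
  assumes "B \<in> dependent_sets G S' - dependent_sets G S"
  shows "card B = 1 \<or> card B = 2"
proof -
  have "card B \<noteq> 0" "\<not> card B \<ge> 3"
    using assms by (auto simp: dependent_sets_iff)
  then show ?thesis by linarith
qed

text \<open>This is the dictionary between cut primes and matroid dependence, read off from the
  images under \<open>cut_hom\<close>.\<close>

lemma set_gen_mem_cut_prime_iff:
  assumes "card B = 1 \<or> card B = 2"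
  shows "set_gen b B \<in> cut_prime G S \<longleftrightarrow> B \<in> dependent_sets G S"
  using assms
proof
  assume "card B = 1"
  then obtain k where "B = {k}" by (auto simp: card_1_singleton_iff)
  then show ?thesis
    by (simp add: set_gen_def mem_cut_prime_iff cut_hom_x cut_hom_y dependent_sets_iff)
next
  assume "card B = 2"
  then obtain i j where B: "B = {i, j}" "i < j"
    by (metis card_2_iff insert_commute linorder_neqE)
  then have "set_gen b B = fbin i j"
    by (simp add: set_gen_def)
  moreover have "(j, i) \<in> linked S \<longleftrightarrow> (i, j) \<in> linked S"
    using linked_sym by blast
  ultimately show ?thesis
    using B by (auto simp: mem_cut_prime_iff cut_hom_fbin dependent_sets_iff)
qed

lemma cut_prime_le_ideal_gen:
  "cut_prime G S \<subseteq> ideal_gen {set_gen b B | b B. B \<in> dependent_sets G S \<and> (card B = 1 \<or> card B = 2)}"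
    (is "_ \<subseteq> ideal_gen ?B")
proof (rule cut_prime_least[OF is_ideal_gen])
  fix i assume i: "i \<in> S"
  then have "{i} \<in> dependent_sets G S" by (simp add: dependent_sets_iff)
  then have "set_gen b {i} \<in> ideal_gen ?B" for b by (intro ideal_gen_base) force
  from this[of False] this[of True] show "xvar i \<in> ideal_gen ?B \<and> yvar i \<in> ideal_gen ?B"
    unfolding set_gen_def[of _ "{i}"] by simp
next
  fix i j assume ij: "i < j" "(i, j) \<in> linked S"
  then have "{i, j} \<in> dependent_sets G S" by (auto simp: dependent_sets_iff)
  moreover have "card {i, j} = 2" using ij by simp
  ultimately have "set_gen False {i, j} \<in> ?B" by blast
  then show "fbin i j \<in> ideal_gen ?B"
    using ideal_gen_base[of "set_gen False {i, j}" ?B] ij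
    unfolding set_gen_def[of _ "{i, j}"] by simp
qed

section \<open>Minimal cuts\<close>

lemma linked_antimono: "S' \<subseteq> S \<Longrightarrow> linked S \<subseteq> linked S'"
  unfolding linked_def
  using rtrancl_mono[of "{(a, b). {a, b} \<in> edges G \<and> a \<notin> S \<and> b \<notin> S}"
      "{(a, b). {a, b} \<in> edges G \<and> a \<notin> S' \<and> b \<notin> S'}"] by auto

text \<open>A walk enters and leaves \<open>i\<close> through neighbours that are already linked
  without \<open>i\<close>, so each visit can be bypassed.\<close>

lemma linked_reroute:
  assumes i: "i \<in> S" and uv: "(u, v) \<in> linked (S - {i})" "u \<notin> S" "v \<notin> S"
    and nb: "\<And>a b. {i, a} \<in> edges G \<Longrightarrow> {i, b} \<in> edges G \<Longrightarrow> a \<notin> S \<Longrightarrow> b \<notin> S \<Longrightarrow> (a, b) \<in> linked S"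
  shows "(u, v) \<in> linked S"
proof -
  have "(u, v) \<in> {(a, b). {a, b} \<in> edges G \<and> a \<notin> S - {i} \<and> b \<notin> S - {i}}\<^sup>*"
    using uv(1) by (simp add: linked_def)
  \<comment> \<open>While the walk stands at \<open>i\<close>, the invariant remembers a neighbour
    of \<open>i\<close> outside \<open>S\<close> that is linked to \<open>u\<close>.\<close>
  then have "if v = i then \<exists>z. z \<notin> S \<and> {i, z} \<in> edges G \<and> (u, z) \<in> linked S else (u, v) \<in> linked S"
  proof (induction rule: rtrancl_induct)
    case base
    show ?case using uv(2) i linked_refl by auto
  next
    case (step w w')
    then have e: "{w, w'} \<in> edges G" "w \<notin> S - {i}" "w' \<notin> S - {i}" by auto
    show ?case
    proof (cases "w = i"; cases "w' = i")
      assume "w = i" "w' = i"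
      then show ?thesis using step.IH by simp
    next
      assume w: "w = i" "w' \<noteq> i"
      then obtain z where "z \<notin> S" "{i, z} \<in> edges G" "(u, z) \<in> linked S"
        using step.IH by auto
      then show ?thesis using w e nb[of z w'] linked_trans by auto
    next
      assume "w \<noteq> i" "w' = i"
      then show ?thesis using step.IH e by (auto simp: insert_commute)
    next
      assume "w \<noteq> i" "w' \<noteq> i"
      then show ?thesis using step.IH e linked_edge[of w w' S] linked_trans[of u w S w'] by auto
    qed
  qed
  moreover have "v \<noteq> i" using uv(3) i by blast
  ultimately show ?thesis by simp
qed

text \<open>Restoring \<open>i\<close> merges the components of its neighbours, so the number drops
  exactly when two of them are distinct.\<close>

lemma cut_point_iff:
  assumes i: "i \<in> S"
  shows "cut_point (induced G (- S \<union> {i})) i \<longleftrightarrow>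
    (\<exists>u v. {i, u} \<in> edges G \<and> {i, v} \<in> edges G \<and> u \<notin> S \<and> v \<notin> S \<and> (u, v) \<notin> linked S)"
proof -
  let ?T = "S - {i}"
  let ?Q = "(- ?T) // linked ?T" and ?R = "(- S) // linked S"
  have T: "- S \<union> {i} = - ?T" using i by auto
  have "induced (induced G (- ?T)) (verts (induced G (- ?T)) - {i}) = induced G (- S)"
    and "i \<in> verts (induced G (- ?T))"
    using i by (auto simp: induced_def)
  then have cp: "cut_point (induced G (- S \<union> {i})) i \<longleftrightarrow> card ?Q < card ?R"
    unfolding T cut_point_def by (simp only: components_induced simp_thms)
  have sub: "linked S \<subseteq> linked ?T" by (rule linked_antimono) auto
  show ?thesis
  proof
    assume "cut_point (induced G (- S \<union> {i})) i"
    then have less: "card ?Q < card ?R" by (simp only: cp)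
    show "\<exists>u v. {i, u} \<in> edges G \<and> {i, v} \<in> edges G \<and> u \<notin> S \<and> v \<notin> S \<and> (u, v) \<notin> linked S"
    proof (rule ccontr)
      assume "\<not> ?thesis"
      then have re: "(u, v) \<in> linked S" if "(u, v) \<in> linked ?T" "u \<notin> S" "v \<notin> S" for u v
        using linked_reroute[OF i that] by blast
      \<comment> \<open>If nothing is merged, each component avoiding \<open>i\<close> is the trace
        of a component of the larger graph, so deletion of \<open>i\<close> cannot raise the
        count.\<close>
      have "?R \<subseteq> (\<lambda>C. C - S) ` ?Q"
      proof
        fix C assume "C \<in> ?R"
        then obtain u where u: "u \<notin> S" "C = linked S `` {u}" by (auto elim!: quotientE)
        then have "C = linked ?T `` {u} - S"
          using re sub linked_notin by blast
        then show "C \<in> (\<lambda>C. C - S) ` ?Q"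
          using u by (auto intro: quotientI)
      qed
      then have "card ?R \<le> card ?Q"
        by (meson card_image_le card_mono finite le_trans)
      then show False using less by simp
    qed
  next
    assume "\<exists>u v. {i, u} \<in> edges G \<and> {i, v} \<in> edges G \<and> u \<notin> S \<and> v \<notin> S \<and> (u, v) \<notin> linked S"
    then obtain u v where uv: "{i, u} \<in> edges G" "{i, v} \<in> edges G" "u \<notin> S" "v \<notin> S" "(u, v) \<notin> linked S"
      by blast
    \<comment> \<open>\<open>f\<close> sends a component to the one containing it after
      \<open>i\<close> is restored. It is onto, since \<open>u\<close> represents the component of
      \<open>i\<close>, and it identifies the components of \<open>u\<close> and
      \<open>v\<close>.\<close>
    define f where "f C = linked ?T `` C" for C
    have f: "f (linked S `` {w}) = linked ?T `` {w}" if "w \<notin> S" for w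
      unfolding f_def using sub linked_refl[OF that] linked_trans by blast
    have iu: "(i, u) \<in> linked ?T" and iv: "(i, v) \<in> linked ?T"
      using uv linked_edge[of i u ?T] linked_edge[of i v ?T] by auto
    have "?Q \<subseteq> f ` ?R"
    proof
      fix D assume "D \<in> ?Q"
      then obtain w where w: "w \<notin> ?T" "D = linked ?T `` {w}" by (auto elim!: quotientE)
      define w' where "w' = (if w = i then u else w)"
      have w': "w' \<notin> S" "D = linked ?T `` {w'}"
        using w uv(3) equiv_class_eq[OF equiv_linked iu] by (auto simp: w'_def)
      then show "D \<in> f ` ?R"
        using f[OF w'(1)] by (auto intro!: image_eqI[of _ f "linked S `` {w'}"] quotientI)
    qed
    then have 1: "card ?Q \<le> card (f ` ?R)" by (simp add: card_mono)
    have "\<not> inj_on f ?R"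
    proof
      assume "inj_on f ?R"
      moreover have "f (linked S `` {u}) = f (linked S `` {v})"
        using f uv(3,4) equiv_class_eq[OF equiv_linked iu] equiv_class_eq[OF equiv_linked iv] by simp
      moreover have "linked S `` {u} \<in> ?R" "linked S `` {v} \<in> ?R"
        using uv(3,4) by (auto intro: quotientI)
      ultimately have "linked S `` {u} = linked S `` {v}"
        by (rule inj_onD)
      then show False
        using uv(4,5) eq_equiv_class[OF _ equiv_linked[of S]] by simp
    qed
    then have "card (f ` ?R) < card ?R"
      by (metis card_image_le eq_card_imp_inj_on finite le_neq_implies_less)
    then show "cut_point (induced G (- S \<union> {i})) i"
      using 1 unfolding cp by linarith
  qed
qed

lemma min_cuts_neighbours:
  assumes "S \<in> min_cuts G" "i \<in> S"
  obtains u v where "{i, u} \<in> edges G" "{i, v} \<in> edges G" "u \<notin> S" "v \<notin> S" "(u, v) \<notin> linked S"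
  using assms cut_point_iff[OF assms(2)] by (auto simp: min_cuts_def minimal_cut_def verts_diff)

text \<open>A vertex of \<open>S'\<close> outside \<open>S\<close> gives a singleton. Otherwise some
  \<open>i\<close> in \<open>S\<close> but not in \<open>S'\<close> connects two of its neighbours
  that \<open>S\<close> separates, giving a pair.\<close>

lemma dependent_sets_diff_nonempty:
  assumes S: "S \<in> min_cuts G" and ne: "S' \<noteq> S"
  shows "dependent_sets G S' - dependent_sets G S \<noteq> {}"
proof (cases "S' \<subseteq> S")
  case False
  then obtain k where "k \<in> S'" "k \<notin> S" by blast
  then have "{k} \<in> dependent_sets G S' - dependent_sets G S"
    by (simp add: dependent_sets_iff)
  then show ?thesis by blast
next
  case True
  then obtain i where i: "i \<in> S" "i \<notin> S'" using ne by blast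
  obtain u v where uv: "{i, u} \<in> edges G" "{i, v} \<in> edges G" "u \<notin> S" "v \<notin> S" "(u, v) \<notin> linked S"
    using min_cuts_neighbours[OF S i(1)] .
  then have "(u, v) \<in> linked S'"
    using i True linked_edge[of i u S'] linked_edge[of i v S'] linked_sym linked_trans by blast
  moreover have "u \<noteq> v" using uv linked_refl by blast
  ultimately have "{u, v} \<in> dependent_sets G S' - dependent_sets G S"
    using uv linked_sym[of v u S] by (auto simp: dependent_sets_iff)
  then show ?thesis by blast
qed

lemma cut_prime_mono:
  assumes "S' \<subseteq> S" "\<And>u v. u \<notin> S \<Longrightarrow> v \<notin> S \<Longrightarrow> (u, v) \<in> linked S' \<Longrightarrow> (u, v) \<in> linked S"
  shows "cut_prime G S' \<subseteq> cut_prime G S"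
  by (rule cut_prime_least[OF is_ideal_cut_prime])
    (use assms in \<open>auto simp: mem_cut_prime_iff cut_hom_x cut_hom_y cut_hom_fbin\<close>)

text \<open>Putting back a vertex of \<open>S\<close> that is not a cut point merges no components,
  hence shrinks the prime; repeating this ends at a minimal cut.\<close>

lemma min_cut_below:
  "\<exists>S'\<in>min_cuts G. cut_prime G S' \<subseteq> cut_prime G S"
proof (induction "card S" arbitrary: S rule: less_induct)
  case less
  show ?case
  proof (cases "\<forall>u v. u \<notin> S \<longrightarrow> v \<notin> S \<longrightarrow> (u, v) \<in> linked S")
    case True
    \<comment> \<open>At most one component is left, and none if \<open>S\<close> is everything; the
      empty cut then lies below.\<close>
    then have "cut_prime G {} \<subseteq> cut_prime G S"
      by (intro cut_prime_mono) auto
    moreover have "{} \<in> min_cuts G"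
      by (simp add: min_cuts_def)
    ultimately show ?thesis by blast
  next
    case False
    then obtain u v where uv: "u \<notin> S" "v \<notin> S" "(u, v) \<notin> linked S" by blast
    show ?thesis
    proof (cases "S \<in> min_cuts G")
      case True
      then show ?thesis by blast
    next
      case notin: False
      \<comment> \<open>At least two components remain, so what fails for a minimal cut is the cut
        point condition at some \<open>i\<close>.\<close>
      have "linked S `` {u} \<noteq> linked S `` {v}"
        using uv eq_equiv_class[OF _ equiv_linked[of S]] by blast
      moreover have "{linked S `` {u}, linked S `` {v}} \<subseteq> (- S) // linked S"
        using uv by (auto intro: quotientI)
      ultimately have "card ((- S) // linked S) \<ge> 2"
        using card_mono[of "(- S) // linked S" "{linked S `` {u}, linked S `` {v}}"] by simp
      moreover have "S \<subset> verts G"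
        using uv(1) by (auto simp: verts)
      ultimately obtain i where i: "i \<in> S" "\<not> cut_point (induced G (- S \<union> {i})) i"
        using notin by (auto simp: min_cuts_def minimal_cut_def verts_diff components_induced)
      have "cut_prime G (S - {i}) \<subseteq> cut_prime G S"
      proof (rule cut_prime_mono)
        fix a b assume "a \<notin> S" "b \<notin> S" "(a, b) \<in> linked (S - {i})"
        then show "(a, b) \<in> linked S"
          using linked_reroute[OF i(1)] i(2)[unfolded cut_point_iff[OF i(1)]] by blast
      qed auto
      moreover have "\<exists>S'\<in>min_cuts G. cut_prime G S' \<subseteq> cut_prime G (S - {i})"
        using i(1) by (intro less.hyps psubset_card_mono) auto
      ultimately show ?thesis by blast
    qed
  qed
qed

lemma mem_binomial_edge_ideal_iff:
  "p \<in> binomial_edge_ideal G \<longleftrightarrow> (\<forall>S\<in>min_cuts G. p \<in> cut_prime G S)"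
  using min_cut_below by (auto simp: binomial_edge_ideal_eq_Inter)

end

section \<open>The localized v-number\<close>

context full_graph
begin

section \<open>Upper bound: transversals give witnesses\<close>

lemma cut_transversals_iff:
  "A \<in> cut_transversals G S \<longleftrightarrow>
     A \<subseteq> (\<Union>S'\<in>min_cuts G - {S}. dependent_sets G S' - dependent_sets G S) \<and>
     (\<forall>S'\<in>min_cuts G - {S}. A \<inter> (dependent_sets G S' - dependent_sets G S) \<noteq> {})"
proof -
  have "cut_Delta G S = (\<lambda>S'. dependent_sets G S' - dependent_sets G S) ` (min_cuts G - {S})"
    by (auto simp: cut_Delta_def)
  then show ?thesis
    by (simp add: cut_transversals_def transversals_def)
qed

lemma cut_transversal_card:
  assumes "A \<in> cut_transversals G S" "B \<in> A"
  shows "B \<notin> dependent_sets G S" "card B = 1 \<or> card B = 2"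
proof -
  obtain S' where "B \<in> dependent_sets G S' - dependent_sets G S"
    using assms by (auto simp: cut_transversals_iff)
  then show "B \<notin> dependent_sets G S" "card B = 1 \<or> card B = 2"
    using card_dependent_diff by blast+
qed

text \<open>The product avoids \<open>cut_prime G S\<close> but lies in every other minimal prime,
  so by primality multiplying into the edge ideal is a condition at \<open>S\<close> alone.\<close>

lemma colon_transversal_gen:
  assumes S: "S \<in> min_cuts G" and A: "A \<in> cut_transversals G S"
  shows "colon (binomial_edge_ideal G) (transversal_gen A (part1 A) {}) = cut_prime G S"
proof -
  have h: "transversal_gen A (part1 A) {} = (\<Prod>B\<in>A. set_gen False B)"
    using transversal_gen_eq_prod[of A "\<lambda>_. False"] cut_transversal_card[OF A] by simp
  have mem: "transversal_gen A (part1 A) {} \<in> cut_prime G S' \<longleftrightarrow> S' \<noteq> S" if "S' \<in> min_cuts G" for S'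
  proof -
    have "transversal_gen A (part1 A) {} \<in> cut_prime G S' \<longleftrightarrow> (\<exists>B\<in>A. B \<in> dependent_sets G S')"
      using cut_transversal_card[OF A] by (simp add: h cut_prime_prod_iff set_gen_mem_cut_prime_iff)
    moreover have "(\<exists>B\<in>A. B \<in> dependent_sets G S') \<longleftrightarrow> S' \<noteq> S"
      using A that cut_transversal_card(1)[OF A] unfolding cut_transversals_iff by blast
    ultimately show ?thesis by simp
  qed
  show ?thesis
    using S mem by (auto simp: colon_def mem_binomial_edge_ideal_iff cut_prime_mult_iff)
qed

section \<open>Lower bound: polynomials whose colon ideal is the given prime\<close>

lemma cut_prime_not_le:
  assumes "S \<in> min_cuts G" "S' \<noteq> S"
  shows "\<not> cut_prime G S' \<subseteq> cut_prime G S"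
proof -
  obtain B where B: "B \<in> dependent_sets G S' - dependent_sets G S"
    using dependent_sets_diff_nonempty[OF assms] by blast
  then show ?thesis
    using set_gen_mem_cut_prime_iff[OF card_dependent_diff[OF B], of False] by blast
qed

text \<open>Multiplication by \<open>h\<close> takes \<open>cut_prime G S\<close> into every other
  minimal prime; primality and incomparability put \<open>h\<close> there. Were \<open>h\<close>
  also in \<open>cut_prime G S\<close>, the colon would contain 1.\<close>

lemma colon_eq_cut_prime_imp:
  assumes h: "colon (binomial_edge_ideal G) h = cut_prime G S"
  shows "h \<notin> cut_prime G S" and "\<And>S'. S' \<in> min_cuts G \<Longrightarrow> S' \<noteq> S \<Longrightarrow> h \<in> cut_prime G S'"
proof -
  show others: "h \<in> cut_prime G S'" if "S' \<in> min_cuts G" "S' \<noteq> S" for S'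
  proof (rule ccontr)
    assume "h \<notin> cut_prime G S'"
    moreover have "g * h \<in> cut_prime G S'" if "g \<in> cut_prime G S" for g
      using that binomial_edge_ideal_le_cut_prime[of S'] unfolding h[symmetric] colon_def by blast
    ultimately have "cut_prime G S \<subseteq> cut_prime G S'"
      by (auto simp: cut_prime_mult_iff)
    then show False
      using cut_prime_not_le[OF that(1)] that(2) by metis
  qed
  show "h \<notin> cut_prime G S"
  proof
    assume "h \<in> cut_prime G S"
    then have "1 * h \<in> binomial_edge_ideal G"
      using others by (auto simp: mem_binomial_edge_ideal_iff)
    then have "1 \<in> colon (binomial_edge_ideal G) h"
      unfolding colon_def by blast
    then show False
      using one_notin_cut_prime h by simp
  qed
qed

text \<open>A product of generators, one from each cut prime other than \<open>P\<^sub>S\<close>, lies in \<open>J\<^sub>G\<close> if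
  one of the factors lies in \<open>P\<^sub>S\<close>; otherwise the supports of the factors form a transversal.\<close>

lemma prod_set_gen_mem:
  fixes b :: "'n set \<Rightarrow> bool" and B :: "'n set \<Rightarrow> 'n set"
  assumes B: "\<And>S'. S' \<in> min_cuts G - {S} \<Longrightarrow> B S' \<in> dependent_sets G S' \<and> (card (B S') = 1 \<or> card (B S') = 2)"
  shows "(\<Prod>S'\<in>min_cuts G - {S}. set_gen (b S') (B S')) \<in> binomial_edge_ideal G + transversal_ideal G S"
    (is "?p \<in> ?J + ?T")
proof (cases "\<exists>S'\<in>min_cuts G - {S}. B S' \<in> dependent_sets G S")
  case True
  have "?p \<in> cut_prime G S'" if "S' \<in> min_cuts G" for S'
    using that True B by (auto simp: cut_prime_prod_iff set_gen_mem_cut_prime_iff)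
  then have "?p \<in> ?J"
    by (simp add: mem_binomial_edge_ideal_iff)
  moreover have "?J \<subseteq> ?J + ?T"
    unfolding transversal_ideal_def by (rule ideal_plus_left[OF is_ideal_gen])
  ultimately show ?thesis by blast
next
  case False
  let ?F = "min_cuts G - {S}"
  define A where "A = B ` ?F"
  \<comment> \<open>Different cuts may choose the same set, so \<open>\<sigma>\<close> picks one cut
    for each member of \<open>A\<close>; the generator is thus only a divisor of the
    product.\<close>
  define \<sigma> where "\<sigma> = inv_into ?F B"
  have \<sigma>: "\<sigma> X \<in> ?F" "B (\<sigma> X) = X" if "X \<in> A" for X
    using that unfolding A_def \<sigma>_def by (rule inv_into_into, rule f_inv_into_f)
  have A: "A \<in> cut_transversals G S"
    using False B by (fastforce simp: A_def cut_transversals_iff)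
  let ?b = "\<lambda>X. b (\<sigma> X)"
  let ?g = "transversal_gen A {k\<in>part1 A. \<not> ?b {k}} {k\<in>part1 A. ?b {k}}"
  have "?g = (\<Prod>X\<in>A. set_gen (?b X) X)"
    by (rule transversal_gen_eq_prod) (use cut_transversal_card[OF A] in blast)
  also have "\<dots> = (\<Prod>S'\<in>\<sigma> ` A. set_gen (b S') (B S'))"
    using \<sigma> by (subst prod.reindex) (auto simp: inj_on_def intro!: prod.cong dest: arg_cong[of _ _ B])
  also have "\<dots> dvd ?p"
    using \<sigma>(1) by (intro prod_dvd_prod_subset) auto
  finally have "?g dvd ?p" .
  moreover have "?g \<in> ?T"
    unfolding transversal_ideal_def using A by (intro ideal_gen_base) fastforce
  ultimately have "?p \<in> ?T"
    using is_ideal_dvd[OF is_ideal_gen] unfolding transversal_ideal_def by blast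
  then show ?thesis
    using ideal_plus_right[OF is_ideal_binomial_edge_ideal] by blast
qed

text \<open>A power of \<open>h\<close> lies in the product of the other minimal primes, whose
  generators are covered by \<open>prod_set_gen_mem\<close>.\<close>

lemma mem_radical_if_mem_other_cut_primes:
  assumes h: "\<And>S'. S' \<in> min_cuts G \<Longrightarrow> S' \<noteq> S \<Longrightarrow> h \<in> cut_prime G S'"
  shows "h \<in> radical (binomial_edge_ideal G + transversal_ideal G S)"
proof -
  let ?K = "binomial_edge_ideal G + transversal_ideal G S"
  let ?B = "\<lambda>S'. {set_gen b B | b B. B \<in> dependent_sets G S' \<and> (card B = 1 \<or> card B = 2)}"
  have "h ^ card (min_cuts G - {S}) \<in> ?K"
  proof (rule power_card_mem_product_ideal[of _ _ ?B])
    show "is_ideal ?K"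
      unfolding transversal_ideal_def by (intro is_ideal_plus is_ideal_binomial_edge_ideal is_ideal_gen)
    show "h \<in> ideal_gen (?B S')" if "S' \<in> min_cuts G - {S}" for S'
      using h that cut_prime_le_ideal_gen by blast
  next
    fix \<gamma> assume \<gamma>: "\<And>S'. S' \<in> min_cuts G - {S} \<Longrightarrow> \<gamma> S' \<in> ?B S'"
    have "\<forall>S'\<in>min_cuts G - {S}. \<exists>bB. \<gamma> S' = set_gen (fst bB) (snd bB) \<and>
        snd bB \<in> dependent_sets G S' \<and> (card (snd bB) = 1 \<or> card (snd bB) = 2)"
      using \<gamma> by fastforce
    then obtain bB where bB: "\<And>S'. S' \<in> min_cuts G - {S} \<Longrightarrow> \<gamma> S' = set_gen (fst (bB S')) (snd (bB S')) \<and>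
        snd (bB S') \<in> dependent_sets G S' \<and> (card (snd (bB S')) = 1 \<or> card (snd (bB S')) = 2)"
      by metis
    have "(\<Prod>S'\<in>min_cuts G - {S}. \<gamma> S') = (\<Prod>S'\<in>min_cuts G - {S}. set_gen (fst (bB S')) (snd (bB S')))"
      using bB by (intro prod.cong) auto
    also have "\<dots> \<in> ?K"
      using bB by (intro prod_set_gen_mem) blast
    finally show "(\<Prod>S'\<in>min_cuts G - {S}. \<gamma> S') \<in> ?K" .
  qed simp
  then show ?thesis
    by (auto simp: radical_def)
qed

text \<open>The homomorphism with kernel \<open>P\<^sub>S\<close> respects total degrees, so low degree terms
  cannot cancel against the transversal ideal modulo \<open>P\<^sub>S\<close>.\<close>

lemma degree_ge_if_mem_sum:
  assumes h: "homogeneous d h" "h \<notin> cut_prime G S" "h \<in> binomial_edge_ideal G + transversal_ideal G S"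
    and \<mu>: "\<And>A. A \<in> cut_transversals G S \<Longrightarrow> \<mu> \<le> card (part1 A) + 2 * card (part2 A)"
  shows "\<mu> \<le> d"
proof (rule ccontr)
  assume "\<not> \<mu> \<le> d"
  obtain j t where jt: "h = j + t" "j \<in> binomial_edge_ideal G" "t \<in> transversal_ideal G S"
    using h(3) by (rule set_plus_elim)
  have "transversal_ideal G S \<subseteq> {p. \<forall>m\<in>Poly_Mapping.keys p. \<mu> \<le> mono_degree m}"
    unfolding transversal_ideal_def
  proof (rule ideal_gen_minimal[OF _ is_ideal_min_degree])
    have "transversal_gen A C D \<in> {p. \<forall>m\<in>Poly_Mapping.keys p. \<mu> \<le> mono_degree m}"
      if "A \<in> cut_transversals G S" "C \<union> D = part1 A" "C \<inter> D = {}" for A C D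
      using \<mu>[OF that(1)] homogeneous_transversal_gen[OF that(2,3)] by (simp add: homogeneous_def)
    then show "{transversal_gen A C D |A C D. A \<in> cut_transversals G S \<and> C \<union> D = part1 A \<and> C \<inter> D = {}}
        \<subseteq> {p. \<forall>m\<in>Poly_Mapping.keys p. \<mu> \<le> mono_degree m}"
      by blast
  qed
  then have t: "\<mu> \<le> mono_degree m" if "m \<in> Poly_Mapping.keys t" for m
    using jt(3) that by blast
  have "cut_hom S j = 0"
    using jt(2) binomial_edge_ideal_le_cut_prime[of S] by (auto simp: mem_cut_prime_iff)
  then have eq: "cut_hom S h = cut_hom S t"
    by (simp add: jt(1) cut_hom_def push_add)
  have "Poly_Mapping.keys (cut_hom S h) = {}"
  proof (rule ccontr)
    assume "Poly_Mapping.keys (cut_hom S h) \<noteq> {}"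
    then obtain k where "k \<in> Poly_Mapping.keys (cut_hom S h)"
      by blast
    moreover from this have "k \<in> Poly_Mapping.keys (cut_hom S t)"
      by (simp only: eq)
    \<comment> \<open>A common monomial of the images comes from a term of \<open>h\<close> of
      degree \<open>d\<close> and a term of \<open>t\<close> of degree at least
      \<open>\<mu>\<close>, yet equal shapes have equal total degree.\<close>
    ultimately obtain m m' where m: "m \<in> Poly_Mapping.keys h" "m' \<in> Poly_Mapping.keys t"
        "shape (cls S) m = shape (cls S) m'"
      unfolding cut_hom_def by (auto dest!: subsetD[OF keys_push])
    then have "mono_degree m = mono_degree m'"
      using vdeg_eq_if_shape_eq[OF m(3)] by (simp add: mono_degree_eq_sum_vdeg)
    then show False
      using m t h(1) \<open>\<not> \<mu> \<le> d\<close> by (auto simp: homogeneous_def)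
  qed
  then show False
    using h(2) by (simp add: mem_cut_prime_iff)
qed

end

theorem theorem1:
  fixes G :: "'n::{finite,linorder} sgraph" and S :: "'n set"
  assumes "simple_graph G" and "verts G = UNIV" and "connected_graph G"
    and "S \<in> min_cuts G"
  shows "v_number (cut_prime G S) (binomial_edge_ideal G)
           \<le> enat (Min {card (part1 A) + 2 * card (part2 A) | A. A \<in> cut_transversals G S})
       \<and> (is_radical (binomial_edge_ideal G + transversal_ideal G S) \<longrightarrow>
          v_number (cut_prime G S) (binomial_edge_ideal G)
           = enat (Min {card (part1 A) + 2 * card (part2 A) | A. A \<in> cut_transversals G S}))"
proof -
  interpret full_graph G
    using assms(2) by unfold_locales
  let ?N = "{card (part1 A) + 2 * card (part2 A) | A. A \<in> cut_transversals G S}"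
  let ?v = "v_number (cut_prime G S) (binomial_edge_ideal G)"
  have N: "?N = (\<lambda>A. card (part1 A) + 2 * card (part2 A)) ` cut_transversals G S"
    by blast
  have fin: "finite ?N"
    unfolding N by simp
  \<comment> \<open>The union of all differences is the largest transversal, as each is nonempty;
    hence \<open>Min\<close> is taken over a nonempty set.\<close>
  have "(\<Union>S'\<in>min_cuts G - {S}. dependent_sets G S' - dependent_sets G S) \<in> cut_transversals G S"
    unfolding cut_transversals_iff using dependent_sets_diff_nonempty[OF assms(4)] by blast
  then have "?N \<noteq> {}" by blast
  then have "Min ?N \<in> ?N"
    using fin by (intro Min_in)
  then obtain A where A: "A \<in> cut_transversals G S" "Min ?N = card (part1 A) + 2 * card (part2 A)"
    by blast
  have "homogeneous (Min ?N) (transversal_gen A (part1 A) {})"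
    unfolding A(2) by (rule homogeneous_transversal_gen) auto
  then have upper: "?v \<le> enat (Min ?N)"
    unfolding v_number_def using colon_transversal_gen[OF assms(4) A(1)] by (intro Inf_lower) blast
  have "enat (Min ?N) \<le> ?v" if rad: "is_radical (binomial_edge_ideal G + transversal_ideal G S)"
    unfolding v_number_def
  proof (rule Inf_greatest)
    fix e assume "e \<in> {enat d |d. \<exists>h. homogeneous d h \<and> colon (binomial_edge_ideal G) h = cut_prime G S}"
    then obtain d h where d: "e = enat d" "homogeneous d h" and h: "colon (binomial_edge_ideal G) h = cut_prime G S"
      by blast
    note h = colon_eq_cut_prime_imp[OF h]
    have "h \<in> binomial_edge_ideal G + transversal_ideal G S"
      using mem_radical_if_mem_other_cut_primes[OF h(2)] rad unfolding is_radical_def by blast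
    then have "Min ?N \<le> d"
      using fin by (intro degree_ge_if_mem_sum[OF d(2) h(1)] Min_le) blast+
    then show "enat (Min ?N) \<le> e"
      by (simp add: d(1))
  qed
  then show ?thesis
    using upper by (auto intro: antisym)
qed

end
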